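(* There exists $\epsilon_0>0$ such that, for all sufficiently large $n$ and every $4$-uniform hypergraph $\mathcal{H}$ on $2n$ vertices with $b(\mathcal{H})<\epsilon_0 n^4$, the following holds: if $\delta_3(\mathcal{H})\geq n-1$, then $\mathcal{H}$ has a Hamiltonian path.
   Context: A path in a $4$-graph is a sequence of distinct vertices $v_1,\dots,v_l$ such that $\{v_i,v_{i+1},v_{i+2},v_{i+3}\}$ is an edge for $i=1,\dots,l-3$; it is Hamiltonian if it contains all vertices. $\delta_3(\mathcal{H})$ is the minimum, over all $3$-sets $T$ of vertices, of the number of vertices $x$ with $T\cup\{x\}\in E(\mathcal{H})$. For a partition $V(\mathcal{H})=A\cup B$, $\mathcal{H}(A,A,B,B)=\{e\in E(\mathcal{H}):|e\cap A|=2\}$, and $b(\mathcal{H})=\min|\mathcal{H}(A,A,B,B)|$ over all partitions with $|A|=|B|=n$. *)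

theory Defs
  imports Complex_Main "HOL-Library.Ramsey"
begin

text \<open>A 4-graph is given by its vertex set \<open>V\<close> and its edge set \<open>E\<close>.\<close>

definition four_graph :: "'a set \<Rightarrow> 'a set set \<Rightarrow> bool" where
  "four_graph V E \<longleftrightarrow> finite V \<and> E \<subseteq> nsets V 4"

definition is_path :: "'a set \<Rightarrow> 'a set set \<Rightarrow> 'a list \<Rightarrow> bool" where
  "is_path V E vs \<longleftrightarrow> distinct vs \<and> set vs \<subseteq> V \<and>
     (\<forall>i. i + 3 < length vs \<longrightarrow> {vs ! i, vs ! (i + 1), vs ! (i + 2), vs ! (i + 3)} \<in> E)"

definition hamiltonian_path :: "'a set \<Rightarrow> 'a set set \<Rightarrow> 'a list \<Rightarrow> bool" where
  "hamiltonian_path V E vs \<longleftrightarrow> is_path V E vs \<and> set vs = V"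

text \<open>The minimum 3-degree is unspecified (a minimum over the empty set) if \<open>V\<close> has
  fewer than three vertices.\<close>

definition delta3 :: "'a set \<Rightarrow> 'a set set \<Rightarrow> nat" where
  "delta3 V E = Min ((\<lambda>T. card {x \<in> V. T \<union> {x} \<in> E}) ` nsets V 3)"

text \<open>The edge set written $H(A,A,B,B)$, for a partition of the vertex set into
  \<open>A\<close> and \<open>B\<close>; as every edge has four vertices, \<open>B\<close> need not be mentioned.\<close>

definition edges_AABB :: "'a set set \<Rightarrow> 'a set \<Rightarrow> 'a set set" where
  "edges_AABB E A = {e \<in> E. card (e \<inter> A) = 2}"

text \<open>If \<open>V\<close> has \<open>2 * n\<close> vertices, both parts of a bisection have size \<open>n\<close>. For an odd
  number of vertices there are no bisections and \<open>bisection_min\<close> is unspecified.\<close>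

definition bisections :: "'a set \<Rightarrow> ('a set \<times> 'a set) set" where
  "bisections V = {(A, B). A \<union> B = V \<and> A \<inter> B = {} \<and> card A = card B}"

definition bisection_min :: "'a set \<Rightarrow> 'a set set \<Rightarrow> nat" where
  "bisection_min V E = Min ((\<lambda>(A, B). card (edges_AABB E A)) ` bisections V)"

end

theory Submission
  imports Defs
begin

text \<open>Let \<open>A, B\<close> be a bisection with few edges of type \<open>AABB\<close>. By the degree condition almost
  all sets of type \<open>AAAB\<close> and \<open>ABBB\<close> are then edges. A path all of whose windows are of type \<open>AAAB\<close>
  has the \<open>4\<close>-periodic pattern \<open>AAABAAAB...\<close>, and likewise for \<open>ABBB\<close>, so one path that leads
  from an \<open>AAAB\<close> stretch to an \<open>ABBB\<close> stretch can be prolonged at both ends; moving the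
  transition point adjusts the number of vertices used in either part.

  The transition exists for the following reason. In the link graph of a typical pair \<open>a, b\<close>,
  every vertex has many neighbours in \<open>A\<close> or many in \<open>B\<close>; since \<open>\<delta>\<^sub>3 \<ge> n - 1\<close>, this graph is connected,
  so some edge \<open>abxy\<close> has \<open>x\<close> of the first and \<open>y\<close> of the second kind.
  The few atypical vertices are put, one by one, into short segments attached to the ends of the path.
  The remaining typical vertices are appended greedily; when only few are left, a new vertex \<open>u\<close>
  takes the place of a vertex already on the path, whose neighbours are exchanged with
  vertices far away, so that every changed window mixes \<open>u\<close> only with freshly chosen vertices.\<close>

section \<open>Good sets and partial arrangements\<close>

text \<open>All exceptional sets go into one family \<open>D\<close>: the missing sets of type AAAB
  and ABBB, and below them every triple, pair and singleton with more than \<open>g\<close>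
  extensions to a bad set one larger. A set of at most three vertices outside \<open>D\<close> then
  has at most \<open>g\<close> bad extensions, so each constraint on a new vertex costs only a
  constant times \<open>g\<close>, a tiny fraction of \<open>n\<close>. Missing sets are rare for
  this reason: a triple with exactly two vertices in \<open>A\<close> has only \<open>n - 2\<close>
  further vertices in \<open>A\<close> but at least \<open>n - 1\<close> neighbours, so each missing
  neighbour in \<open>A\<close> is paid for by a neighbour in \<open>B\<close>, which may be charged
  to an AABB edge.

  The obstacle is the endgame. Greedy choice needs more than \<open>32 * g\<close> candidates, and a
  late vertex \<open>u\<close> is merely known to be a good singleton, so it may fit nowhere.
  Emptying the positions within distance 3 of \<open>u\<close> removes every constraint between
  \<open>u\<close> and old neighbours. The displaced vertices return by exchanges inside one residue
  class mod 4, which keep the pattern; this works if they fit almost everywhere, and averaging shows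
  that all but a few vertices do.\<close>

lemma not_subset_of_card_less: "finite Y \<Longrightarrow> card Y < card X \<Longrightarrow> \<not> X \<subseteq> Y"
  by (meson card_mono not_less)

locale bad_sets =
  fixes V :: "'a set" and D :: "'a set set" and g :: nat
  assumes finite_V: "finite V"
    and empty_notin_D: "{} \<notin> D"
    and few_bad: "S \<subseteq> V \<Longrightarrow> card S \<le> 3 \<Longrightarrow> S \<notin> D \<Longrightarrow> card {z \<in> V. insert z S \<in> D} \<le> g"
begin

definition ok :: "'a set \<Rightarrow> bool" where
  "ok W \<longleftrightarrow> (\<forall>S\<subseteq>W. S \<notin> D)"

lemma ok_mono: "ok W \<Longrightarrow> W' \<subseteq> W \<Longrightarrow> ok W'"
  by (auto simp: ok_def)

lemma ok_empty: "ok {}"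
  using empty_notin_D by (simp add: ok_def)

lemma ok_singleton: "{v} \<notin> D \<Longrightarrow> ok {v}"
  using empty_notin_D by (auto simp: ok_def subset_singleton_iff)

lemma ok_memberD: "ok W \<Longrightarrow> v \<in> W \<Longrightarrow> {v} \<notin> D"
  by (auto simp: ok_def)

text \<open>A vertex spoils \<open>W\<close> only by completing one of its at most
  \<open>2 ^ 3\<close> subsets, all of them good, to a bad set.\<close>

lemma card_not_ok:
  assumes "W \<subseteq> V" "card W \<le> 3" "ok W"
  shows "card {z \<in> V. \<not> ok (insert z W)} \<le> 8 * g"
proof -
  have fW: "finite W" using assms(1) finite_V finite_subset by blast
  have "{z \<in> V. \<not> ok (insert z W)} \<subseteq> (\<Union>S\<in>Pow W. {z \<in> V. insert z S \<in> D})"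
  proof
    fix z assume z: "z \<in> {z \<in> V. \<not> ok (insert z W)}"
    then obtain S where S: "S \<subseteq> insert z W" "S \<in> D" by (auto simp: ok_def)
    then have "z \<in> S" using assms(3) by (auto simp: ok_def)
    then have "insert z (S - {z}) = S" by auto
    then show "z \<in> (\<Union>S\<in>Pow W. {z \<in> V. insert z S \<in> D})"
      using S z by (intro UN_I[of "S - {z}"]) auto
  qed
  then have "card {z \<in> V. \<not> ok (insert z W)} \<le> card (\<Union>S\<in>Pow W. {z \<in> V. insert z S \<in> D})"
    using finite_V fW by (intro card_mono) auto
  also have "\<dots> \<le> (\<Sum>S\<in>Pow W. card {z \<in> V. insert z S \<in> D})"
    using fW by (intro card_UN_le) auto
  also have "\<dots> \<le> (\<Sum>S\<in>Pow W. g)"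
  proof (rule sum_mono)
    fix S assume "S \<in> Pow W"
    then show "card {z \<in> V. insert z S \<in> D} \<le> g"
      using assms fW card_mono[of W S] by (intro few_bad) (auto simp: ok_def)
  qed
  also have "\<dots> = 2 ^ card W * g" using fW by (simp add: card_Pow)
  also have "\<dots> \<le> 2 ^ 3 * g" using assms(2) by (intro mult_right_mono power_increasing) auto
  finally show ?thesis by simp
qed

lemma pick_ok:
  assumes "W \<subseteq> V" "card W \<le> 3" "ok W" "X \<subseteq> V" "finite F" "card F + 8 * g < card X"
  obtains z where "z \<in> X" "z \<notin> F" "ok (insert z W)"
proof -
  have "card (F \<union> {z \<in> V. \<not> ok (insert z W)}) \<le> card F + 8 * g"
    using card_Un_le[of F "{z \<in> V. \<not> ok (insert z W)}"] card_not_ok[OF assms(1-3)] by linarith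
  then have "\<not> X \<subseteq> F \<union> {z \<in> V. \<not> ok (insert z W)}"
    using assms(5,6) finite_V by (intro not_subset_of_card_less) auto
  then show ?thesis using that assms(4) by blast
qed

text \<open>A partial arrangement \<open>f\<close> occupies the positions in \<open>P\<close>; the positions outside \<open>P\<close> are holes, and
  the values of \<open>f\<close> there are ignored.\<close>

definition ok_on :: "(nat \<Rightarrow> 'a) \<Rightarrow> nat set \<Rightarrow> bool" where
  "ok_on f P \<longleftrightarrow> (\<forall>i. ok (f ` (P \<inter> {i..i + 3})))"

text \<open>Removing \<open>p\<close> from \<open>P\<close> lets the same notion serve for filling a
  hole and for replacing the vertex at an occupied position.\<close>

definition fits :: "(nat \<Rightarrow> 'a) \<Rightarrow> nat set \<Rightarrow> nat \<Rightarrow> 'a \<Rightarrow> bool" where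
  "fits f P p z \<longleftrightarrow> (\<forall>i. p \<in> {i..i + 3} \<longrightarrow> ok (insert z (f ` ((P - {p}) \<inter> {i..i + 3}))))"

lemma ok_on_mono: "ok_on f P \<Longrightarrow> P' \<subseteq> P \<Longrightarrow> ok_on f P'"
  unfolding ok_on_def by (meson Int_mono image_mono ok_mono order_refl)

text \<open>Only positions within distance 3 share a window with \<open>p\<close>. This transfers
  what is known about an untouched arrangement to a later one that agrees with it near
  \<open>p\<close>.\<close>

lemma fits_cong:
  assumes "\<And>i. i + 3 \<ge> p \<Longrightarrow> i \<le> p + 3 \<Longrightarrow> i \<noteq> p \<Longrightarrow> (i \<in> P \<longleftrightarrow> i \<in> P') \<and> (i \<in> P \<longrightarrow> f i = f' i)"
  shows "fits f P p z = fits f' P' p z"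
proof -
  have "f ` ((P - {p}) \<inter> {i..i + 3}) = f' ` ((P' - {p}) \<inter> {i..i + 3})" if "p \<in> {i..i+3}" for i
  proof (rule image_cong)
    show "(P - {p}) \<inter> {i..i + 3} = (P' - {p}) \<inter> {i..i + 3}"
      using assms that by fastforce
    fix x assume "x \<in> (P' - {p}) \<inter> {i..i + 3}"
    then show "f x = f' x" using assms[of x] that by auto
  qed
  then show ?thesis unfolding fits_def by auto
qed

lemma ok_on_fill:
  assumes "ok_on f P" "fits f P p z"
  shows "ok_on (f(p := z)) (insert p P)"
  unfolding ok_on_def
proof
  fix i
  show "ok (f(p := z) ` (insert p P \<inter> {i..i + 3}))"
  proof (cases "p \<in> {i..i + 3}")
    case True
    then have "f(p := z) ` (insert p P \<inter> {i..i + 3}) = insert z (f ` ((P - {p}) \<inter> {i..i + 3}))"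
      by auto
    then show ?thesis using assms(2) True unfolding fits_def by simp
  next
    case False
    then have "f(p := z) ` (insert p P \<inter> {i..i + 3}) = f ` (P \<inter> {i..i + 3})"
      by auto
    then show ?thesis using assms(1) unfolding ok_on_def by simp
  qed
qed

lemma card_not_fits:
  assumes "ok_on f P" "f ` P \<subseteq> V"
  shows "card {z \<in> V. \<not> fits f P p z} \<le> 32 * g"
proof -
  let ?W = "\<lambda>i. f ` ((P - {p}) \<inter> {i..i + 3})"
  have "{z \<in> V. \<not> fits f P p z} \<subseteq> (\<Union>i\<in>{p - 3..p}. {z \<in> V. p \<in> {i..i+3} \<and> \<not> ok (insert z (?W i))})"
    unfolding fits_def by (auto, force)
  then have "card {z \<in> V. \<not> fits f P p z}
      \<le> card (\<Union>i\<in>{p - 3..p}. {z \<in> V. p \<in> {i..i+3} \<and> \<not> ok (insert z (?W i))})"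
    using finite_V by (intro card_mono) auto
  also have "\<dots> \<le> (\<Sum>i\<in>{p - 3..p}. card {z \<in> V. p \<in> {i..i+3} \<and> \<not> ok (insert z (?W i))})"
    by (intro card_UN_le) auto
  also have "\<dots> \<le> (\<Sum>i\<in>{p - 3..p}. 8 * g)"
  proof (rule sum_mono)
    fix i assume i: "i \<in> {p - 3..p}"
    show "card {z \<in> V. p \<in> {i..i+3} \<and> \<not> ok (insert z (?W i))} \<le> 8 * g"
    proof (cases "p \<in> {i..i+3}")
      case True
      have "card (?W i) \<le> card ((P - {p}) \<inter> {i..i + 3})" by (rule card_image_le) auto
      also have "\<dots> \<le> card ({i..i + 3} - {p})" by (rule card_mono) auto
      also have "\<dots> = 3" using True by (subst card_Diff_singleton) auto
      finally have "card (?W i) \<le> 3" .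
      moreover have "ok (?W i)" using assms(1) unfolding ok_on_def
        by (rule_tac ok_mono[where W = "f ` (P \<inter> {i..i + 3})"]) auto
      moreover have "?W i \<subseteq> V" using assms(2) by auto
      ultimately show ?thesis using card_not_ok[of "?W i"] True by simp
    next
      case False
      then have "{z \<in> V. p \<in> {i..i+3} \<and> \<not> ok (insert z (?W i))} = {}" by blast
      then show ?thesis by (simp only: card.empty)
    qed
  qed
  also have "\<dots> \<le> 4 * (8 * g)"
    by (simp only: sum_constant of_nat_id, rule mult_right_mono) auto
  finally show ?thesis by simp
qed

text \<open>At distance at least 4 no window contains both \<open>p\<close> and \<open>l\<close>, so
  the two replacements can be checked independently. The waiting vertex \<open>f p\<close> goes to
  \<open>l\<close>, and \<open>f l\<close> fills the hole.\<close>

lemma ok_on_swap: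
  assumes "ok_on f P" "p \<notin> P" "l \<in> P" "p + 4 \<le> l \<or> l + 4 \<le> p" "fits f P p (f l)" "fits f P l (f p)"
  shows "ok_on (f(p := f l, l := f p)) (insert p P)"
proof -
  have "ok_on (f(l := f p)) P"
    using ok_on_fill[OF assms(1,6)] assms(3) by (simp add: insert_absorb)
  moreover have "fits (f(l := f p)) P p (f l)"
    using assms(5) by (rule iffD2[OF fits_cong, rotated]) (use assms(4) in auto)
  ultimately have "ok_on (f(l := f p, p := f l)) (insert p P)"
    by (rule ok_on_fill)
  then show ?thesis using assms(2,3) by (metis fun_upd_twist)
qed

end

section \<open>Extending an arrangement by swaps\<close>

lemma card_residue_class: "(b - a) div 4 \<le> card {i \<in> {a..<b}. i mod 4 = r mod (4::nat)}"
proof -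
  have "\<exists>s. a \<le> s \<and> s \<le> a + 3 \<and> s mod 4 = r mod 4" by presburger
  then obtain s where s: "a \<le> s" "s \<le> a + 3" "s mod 4 = r mod 4" by blast
  have "(\<lambda>k. s + 4 * k) ` {..<(b - a) div 4} \<subseteq> {i \<in> {a..<b}. i mod 4 = r mod 4}"
  proof
    fix i assume "i \<in> (\<lambda>k. s + 4 * k) ` {..<(b - a) div 4}"
    then obtain k where k: "k < (b - a) div 4" "i = s + 4 * k" by auto
    then have "i < b" using s by linarith
    moreover have "i mod 4 = r mod 4" using k s by simp
    ultimately show "i \<in> {i \<in> {a..<b}. i mod 4 = r mod 4}" using k s by auto
  qed
  then have "card ((\<lambda>k. s + 4 * k) ` {..<(b - a) div 4}) \<le> card {i \<in> {a..<b}. i mod 4 = r mod 4}"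
    by (intro card_mono) auto
  moreover have "card ((\<lambda>k. s + 4 * k) ` {..<(b - a) div 4}) = (b - a) div 4"
    by (subst card_image) (auto simp: inj_on_def)
  ultimately show ?thesis by simp
qed

lemma card_neighbourhood:
  fixes C :: "nat set"
  assumes "finite C"
  shows "card (\<Union>c\<in>C. {c - 3..c + 3}) \<le> 7 * card C"
proof -
  have "card (\<Union>c\<in>C. {c - 3..c + 3}) \<le> (\<Sum>c\<in>C. card {c - 3..c + 3})"
    using assms by (rule card_UN_le)
  also have "\<dots> \<le> (\<Sum>c\<in>C. 7)" by (rule sum_mono) auto
  finally show ?thesis by simp
qed

lemma card_inj_preimage:
  assumes "inj_on f P" "finite B"
  shows "card {l \<in> P. f l \<in> B} \<le> card B"
proof -
  have "card (f ` {l \<in> P. f l \<in> B}) \<le> card B" using assms by (intro card_mono) auto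
  then show ?thesis using assms by (subst (asm) card_image) (auto intro: inj_on_subset)
qed

context bad_sets
begin

text \<open>The value \<open>F p\<close> at a hole \<open>p\<close> is the vertex still waiting to be placed. The set \<open>C\<close> collects the
  positions touched so far; windows away from \<open>C\<close> look as in the original arrangement \<open>f\<close>.\<close>

lemma fill_holes_by_swaps:
  assumes "ok_on F ({..m} - H)" "H \<subseteq> C" "C \<subseteq> {..m}" "m \<in> C" "{0, 1, 2} \<subseteq> C" "H \<inter> {0, 1, 2} = {}"
    and "card C + card H \<le> K"
    and "\<forall>i\<in>{..m} - C. F i = f i" "inj_on F {..m}" "F ` {..m} \<subseteq> V"
    and "\<forall>p\<in>H. card {l \<in> {..<m}. \<not> fits f {..<m} l (F p)} \<le> d"
    and room: "7 * K + d + 32 * g < m div 4"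
  shows "\<exists>F'. ok_on F' {..m} \<and> inj_on F' {..m} \<and> F' ` {..m} = F ` {..m} \<and> (\<forall>i<3. F' i = F i) \<and>
           (\<forall>i\<le>m. \<exists>k\<le>m. F' i = F k \<and> k mod 4 = i mod 4)"
  using assms(1-11)
proof (induction "card H" arbitrary: F C H)
  case 0
  have "finite H" using 0(3,4) by (meson finite_atMost finite_subset)
  then have "H = {}" using 0(1) by simp
  then have "ok_on F {..m}" using 0(2) by simp
  then show ?case using 0(10) by (intro exI[of _ F]) auto
next
  case (Suc k)
  have finC: "finite C" using Suc.prems(3) finite_subset by blast
  then have finH: "finite H" using Suc.prems(2) finite_subset by blast
  obtain p where p: "p \<in> H" using Suc.hyps(2) by fastforce
  have "p \<notin> {0, 1, 2}" using p Suc.prems(6) by blast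
  then have pm: "p \<in> C" "p \<le> m" "p \<ge> 3" using p Suc.prems(2,3) by auto
  \<comment> \<open>The three ways in which a partner \<open>l\<close> can fail: it is too close to
    a touched position, the waiting vertex does not fit there, or \<open>F l\<close> does not fit at
    the hole \<open>p\<close>. Avoiding them inside the residue class of \<open>p\<close> preserves
    the pattern.\<close>
  define Bd where "Bd = (\<Union>c\<in>C. {c - 3..c + 3}) \<union> {l \<in> {..<m}. \<not> fits f {..<m} l (F p)}
     \<union> {l \<in> {..m}. F l \<in> {z \<in> V. \<not> fits F ({..m} - H) p z}}"
  have finBd: "finite Bd" using finC unfolding Bd_def by simp
  have "card Bd \<le> 7 * card C + d + 32 * g"
  proof -
    have "card {l \<in> {..m}. F l \<in> {z \<in> V. \<not> fits F ({..m} - H) p z}} \<le> 32 * g"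
      using card_inj_preimage[OF Suc.prems(9), of "{z \<in> V. \<not> fits F ({..m} - H) p z}"]
        card_not_fits[OF Suc.prems(1), of p] Suc.prems(10) finite_V by fastforce
    moreover have "card {l \<in> {..<m}. \<not> fits f {..<m} l (F p)} \<le> d" using Suc.prems(11) p by blast
    ultimately show ?thesis unfolding Bd_def
      using card_neighbourhood[OF finC] by (intro order_trans[OF card_Un_le] add_mono) auto
  qed
  also have "\<dots> < m div 4" using Suc.prems(7) room by linarith
  also have "\<dots> \<le> card {i \<in> {0..<m}. i mod 4 = p mod 4}"
    using card_residue_class[of m 0 p] by simp
  finally have "\<not> {i \<in> {0..<m}. i mod 4 = p mod 4} \<subseteq> Bd"
    using finBd by (intro not_subset_of_card_less)
  then obtain l where l: "l < m" "l mod 4 = p mod 4" "l \<notin> Bd" by auto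
  have far: "c + 4 \<le> l \<or> l + 4 \<le> c" if "c \<in> C" for c
  proof -
    have "l \<notin> {c - 3..c + 3}" using l(3) that unfolding Bd_def by blast
    then show ?thesis by auto
  qed
  have lC: "l \<notin> C" "l \<notin> H" "l \<noteq> p" "l \<ge> 3" "l + 4 \<le> m"
    using far[of l] far[of p] far[of 0] far[of m] Suc.prems(2,4,5) pm p l(1) by auto
  \<comment> \<open>The flexibility of \<open>F p\<close> is known only for the original
    \<open>f\<close>; since \<open>l\<close> is far from \<open>C\<close>, both arrangements agree
    around \<open>l\<close>.\<close>
  have fitsl: "fits F ({..m} - H) l (F p)"
  proof -
    have "fits f {..<m} l (F p)" using l unfolding Bd_def by auto
    then show ?thesis
    proof (rule iffD1[OF fits_cong, rotated])
      fix i assume i: "i + 3 \<ge> l" "i \<le> l + 3" "i \<noteq> l"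
      then have "i \<notin> C" using far[of i] by auto
      moreover have "i < m" using i lC by linarith
      ultimately show "(i \<in> {..<m} \<longleftrightarrow> i \<in> {..m} - H) \<and> (i \<in> {..<m} \<longrightarrow> f i = F i)"
        using Suc.prems(2,8) by auto
    qed
  qed
  have "F l \<in> V" using l(1) Suc.prems(10) by auto
  then have fitsp: "fits F ({..m} - H) p (F l)" using l unfolding Bd_def by auto
  define G where "G = F(p := F l, l := F p)"
  have ins: "insert p ({..m} - H) = {..m} - (H - {p})" using p pm by auto
  have "ok_on G (insert p ({..m} - H))" unfolding G_def
    by (rule ok_on_swap) (use Suc.prems(1) p l lC far[of p] pm fitsl fitsp in auto)
  then have 1: "ok_on G ({..m} - (H - {p}))" unfolding ins .
  have GT: "G = F \<circ> (\<lambda>x. if x = p then l else if x = l then p else x)" (is "_ = F \<circ> ?t")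
    unfolding G_def by auto
  have t: "bij_betw ?t {..m} {..m}"
    by (rule bij_betw_byWitness[where f' = ?t]) (use pm l in auto)
  have 2: "inj_on G {..m}" unfolding GT
    by (rule comp_inj_on) (use t Suc.prems(9) in \<open>auto simp: bij_betw_def\<close>)
  have 3: "G ` {..m} = F ` {..m}" unfolding GT image_comp[symmetric] using t by (simp add: bij_betw_def)
  have 4: "\<forall>q\<in>H - {p}. G q = F q" using lC unfolding G_def by auto
  have "\<exists>F'. ok_on F' {..m} \<and> inj_on F' {..m} \<and> F' ` {..m} = G ` {..m} \<and> (\<forall>i<3. F' i = G i) \<and>
           (\<forall>i\<le>m. \<exists>k\<le>m. F' i = G k \<and> k mod 4 = i mod 4)"
  proof (rule Suc.hyps(1)[where C = "insert l C" and H = "H - {p}"])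
    show "k = card (H - {p})" using Suc.hyps(2) p finH by simp
    have "card (insert l C) = Suc (card C)" "card (H - {p}) + 1 = card H"
      using lC finC p Suc.hyps(2) finH by auto
    then show "card (insert l C) + card (H - {p}) \<le> K" using Suc.prems(7) by linarith
    show "\<forall>i\<in>{..m} - insert l C. G i = f i" using Suc.prems(8) pm unfolding G_def by auto
    show "\<forall>q\<in>H - {p}. card {l \<in> {..<m}. \<not> fits f {..<m} l (G q)} \<le> d"
      using 4 Suc.prems(11) by auto
    show "(H - {p}) \<inter> {0, 1, 2} = {}" using Suc.prems(6) by blast
  qed (use 1 2 3 Suc.prems l in auto)
  then obtain F' where F': "ok_on F' {..m}" "inj_on F' {..m}" "F' ` {..m} = G ` {..m}" "\<forall>i<3. F' i = G i"
      "\<forall>i\<le>m. \<exists>k\<le>m. F' i = G k \<and> k mod 4 = i mod 4" by blast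
  have "\<forall>i<3. G i = F i" using lC pm unfolding G_def by auto
  moreover have *: "\<exists>k'\<le>m. G k = F k' \<and> k' mod 4 = k mod 4" if "k \<le> m" for k
    using that l pm unfolding G_def by (intro exI[of _ "if k = p then l else if k = l then p else k"]) auto
  then have "\<forall>i\<le>m. \<exists>k\<le>m. F' i = F k \<and> k mod 4 = i mod 4" using F'(5) by metis
  ultimately show ?case using F'(1-4) 3 by (intro exI[of _ F'] conjI) auto
qed

section \<open>Averaging: most vertices fit at most positions\<close>

lemma double_count:
  assumes "finite S" "finite T"
  shows "(\<Sum>w\<in>T. card {l \<in> S. R l w}) = (\<Sum>l\<in>S. card {w \<in> T. R l w})"
  by (simp only: card_eq_sum, rule sum.swap_restrict) (use assms in auto)

text \<open>Count pairs of a position and a vertex not fitting there: each position rejects at most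
  \<open>32 * g\<close> vertices. Since \<open>m\<close> is at most 17 times
  \<open>m div 16\<close>, this gives \<open>17 * 32 = 544\<close>.\<close>

lemma card_inflexible:
  assumes "ok_on f {..<m}" "f ` {..<m} \<subseteq> V" "17 * 16 \<le> m"
  shows "card {w \<in> V. m div 16 < card {l \<in> {..<m}. \<not> fits f {..<m} l w}} \<le> 544 * g"
proof -
  let ?N = "{w \<in> V. m div 16 < card {l \<in> {..<m}. \<not> fits f {..<m} l w}}"
  have "card ?N * (m div 16) = (\<Sum>w\<in>?N. m div 16)" by simp
  also have "\<dots> \<le> (\<Sum>w\<in>?N. card {l \<in> {..<m}. \<not> fits f {..<m} l w})" by (rule sum_mono) auto
  also have "\<dots> \<le> (\<Sum>w\<in>V. card {l \<in> {..<m}. \<not> fits f {..<m} l w})"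
    using finite_V by (intro sum_mono2) auto
  also have "\<dots> = (\<Sum>l\<in>{..<m}. card {w \<in> V. \<not> fits f {..<m} l w})"
    using finite_V by (intro double_count) auto
  also have "\<dots> \<le> (\<Sum>l\<in>{..<m}. 32 * g)"
    by (rule sum_mono) (rule card_not_fits[OF assms(1,2)])
  also have "\<dots> = m * (32 * g)" by simp
  also have "\<dots> \<le> (17 * (m div 16)) * (32 * g)" using assms(3) by (intro mult_right_mono) linarith+
  finally have "card ?N * (m div 16) \<le> (544 * g) * (m div 16)" by (simp add: algebra_simps)
  then show ?thesis using assms(3) by simp
qed

text \<open>A position \<open>j\<close> in the residue class of \<open>m\<close> is chosen so that
  \<open>f j\<close> fits at \<open>m\<close> and every vertex within distance 3 of \<open>j\<close>
  fits at all but \<open>m div 16\<close> positions. Then \<open>f j\<close> moves to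
  \<open>m\<close>, \<open>u\<close> moves to \<open>j\<close>, and the six positions around
  \<open>j\<close> become holes for \<open>fill_holes_by_swaps\<close>.\<close>

lemma extend_by_swaps:
  assumes "ok_on f {..<m}" "inj_on f {..<m}" "f ` {..<m} \<subseteq> V" "u \<in> V" "{u} \<notin> D" "u \<notin> f ` {..<m}"
    and m: "20000 * g + 20000 \<le> m"
  shows "\<exists>F. ok_on F {..m} \<and> inj_on F {..m} \<and> F ` {..m} = insert u (f ` {..<m}) \<and> (\<forall>i<3. F i = f i) \<and>
           (\<forall>i\<le>m. \<exists>k\<le>m. F i = (f(m := u)) k \<and> k mod 4 = i mod 4)"
proof -
  define NF where "NF = {w \<in> V. m div 16 < card {l \<in> {..<m}. \<not> fits f {..<m} l w}}"
  have NF: "card NF \<le> 544 * g" unfolding NF_def using assms m by (intro card_inflexible) auto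
  have finNF: "finite NF" using finite_V unfolding NF_def by simp
  define Bd where "Bd = (\<Union>i\<in>{l \<in> {..<m}. f l \<in> NF}. {i - 3..i + 3})
      \<union> {l \<in> {..<m}. f l \<in> {z \<in> V. \<not> fits f {..<m} m z}}"
  have finBd: "finite Bd" unfolding Bd_def by auto
  have "card Bd \<le> 7 * (544 * g) + 32 * g"
  proof -
    have "card {l \<in> {..<m}. f l \<in> {z \<in> V. \<not> fits f {..<m} m z}} \<le> 32 * g"
      using card_inj_preimage[OF assms(2), of "{z \<in> V. \<not> fits f {..<m} m z}"]
        card_not_fits[OF assms(1,3), of m] finite_V by fastforce
    moreover have "card (\<Union>i\<in>{l \<in> {..<m}. f l \<in> NF}. {i - 3..i + 3}) \<le> 7 * (544 * g)"
      using card_neighbourhood[of "{l \<in> {..<m}. f l \<in> NF}"] card_inj_preimage[OF assms(2) finNF] NF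
      by fastforce
    ultimately show ?thesis unfolding Bd_def by (intro order_trans[OF card_Un_le] add_mono) auto
  qed
  also have "\<dots> < (m - 7 - 7) div 4"
    unfolding Suc_le_eq[symmetric] by (subst less_eq_div_iff_mult_less_eq) (use m in auto)
  also have "\<dots> \<le> card {i \<in> {7..<m - 7}. i mod 4 = m mod 4}"
    using card_residue_class[of "m - 7" 7 m] by simp
  finally have "\<not> {i \<in> {7..<m - 7}. i mod 4 = m mod 4} \<subseteq> Bd"
    using finBd by (intro not_subset_of_card_less)
  then obtain j where "j \<in> {7..<m - 7}" and j': "j mod 4 = m mod 4" "j \<notin> Bd" by blast
  then have j: "7 \<le> j" "j + 7 < m" "j mod 4 = m mod 4" "j \<notin> Bd" by auto
  have flex: "card {l \<in> {..<m}. \<not> fits f {..<m} l (f i)} \<le> m div 16" if "i \<in> {j - 3..j + 3}" for i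
  proof -
    have im: "i < m" using that j by auto
    have "i \<notin> {l \<in> {..<m}. f l \<in> NF}"
    proof
      assume "i \<in> {l \<in> {..<m}. f l \<in> NF}"
      moreover have "j \<in> {i - 3..i + 3}" using that by auto
      ultimately show False using j(4) unfolding Bd_def by blast
    qed
    then show ?thesis using im assms(3) unfolding NF_def by (auto simp: image_subset_iff not_less)
  qed
  have "f j \<in> V" using j assms(3) by auto
  then have fitm: "fits f {..<m} m (f j)" using j unfolding Bd_def by auto
  define H where "H = {j - 3..j + 3} - {j}"
  define F where "F = f(m := f j, j := u)"
  have "ok_on (f(m := f j)) (insert m {..<m})" using assms(1) fitm by (rule ok_on_fill)
  then have "ok_on (f(m := f j)) (insert m {..<m} - {j - 3..j + 3})" by (rule ok_on_mono) auto
  \<comment> \<open>With the six neighbours vacated, each window through \<open>j\<close> contains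
    nothing but \<open>u\<close>; hence goodness of the singleton suffices.\<close>
  moreover have "fits (f(m := f j)) (insert m {..<m} - {j - 3..j + 3}) j u"
    unfolding fits_def
  proof (intro allI impI)
    fix i assume i: "j \<in> {i..i + 3}"
    have "(insert m {..<m} - {j - 3..j + 3} - {j}) \<inter> {i..i + 3} = {}" using i j by auto
    then show "ok (insert u (f(m := f j) ` ((insert m {..<m} - {j - 3..j + 3} - {j}) \<inter> {i..i + 3})))"
      using ok_singleton[OF assms(5)] by (simp only: image_empty)
  qed
  ultimately have "ok_on F (insert j (insert m {..<m} - {j - 3..j + 3}))"
    unfolding F_def by (rule ok_on_fill)
  moreover have "insert j (insert m {..<m} - {j - 3..j + 3}) = {..m} - H" unfolding H_def using j by auto
  ultimately have okF: "ok_on F ({..m} - H)" by simp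
  have FT: "F i = ((f(m := u)) \<circ> (\<lambda>x. if x = j then m else if x = m then j else x)) i" (is "_ = (_ \<circ> ?t) i") for i
    unfolding F_def using j by auto
  have t: "bij_betw ?t {..m} {..m}"
    by (rule bij_betw_byWitness[where f' = ?t]) (use j in auto)
  have m1: "{..m} = insert m {..<m}" by auto
  have inju: "inj_on (f(m := u)) {..m}" unfolding m1 using assms(2,6)
    by (auto simp: inj_on_def image_iff)
  have imu: "(f(m := u)) ` {..m} = insert u (f ` {..<m})" unfolding m1 by auto
  have "inj_on ((f(m := u)) \<circ> ?t) {..m}"
    by (rule comp_inj_on) (use t inju in \<open>auto simp: bij_betw_def\<close>)
  then have injF: "inj_on F {..m}" using FT inj_on_cong[of "{..m}" F] by blast
  have "F ` {..m} = ((f(m := u)) \<circ> ?t) ` {..m}" using FT by (intro image_cong) auto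
  also have "\<dots> = (f(m := u)) ` {..m}" unfolding image_comp[symmetric] using t by (simp add: bij_betw_def)
  finally have imF: "F ` {..m} = insert u (f ` {..<m})" using imu by simp
  have cC: "card ({0, 1, 2, m} \<union> {j - 3..j + 3}) + card H \<le> 17"
  proof -
    have "card {0, 1, 2, m} \<le> 4" by (simp add: card_insert_if)
    moreover have "card {j - 3..j + 3} \<le> 7" by auto
    moreover have "card H = card {j - 3..j + 3} - 1" unfolding H_def by (subst card_Diff_singleton) auto
    ultimately show ?thesis using card_Un_le[of "{0, 1, 2, m}" "{j - 3..j + 3}"] by linarith
  qed
  have "\<exists>F'. ok_on F' {..m} \<and> inj_on F' {..m} \<and> F' ` {..m} = F ` {..m} \<and> (\<forall>i<3. F' i = F i) \<and>
           (\<forall>i\<le>m. \<exists>k\<le>m. F' i = F k \<and> k mod 4 = i mod 4)"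
  proof (rule fill_holes_by_swaps[where f = f and d = "m div 16" and K = 17
        and C = "{0, 1, 2, m} \<union> {j - 3..j + 3}" and H = H])
    \<comment> \<open>The bound 17 counts at most eleven touched positions (the first three,
      \<open>m\<close>, and seven around \<open>j\<close>) plus six holes. Each exchange turns a
      hole into a new touched position, so the sum never grows.\<close>
    have "7 * 17 + a + 32 * g < b" if "16 * a \<le> m" "m < 4 * b + 4" for a b
      using m that by linarith
    then show "7 * 17 + m div 16 + 32 * g < m div 4" by auto
    show "\<forall>p\<in>H. card {l \<in> {..<m}. \<not> fits f {..<m} l (F p)} \<le> m div 16"
    proof
      fix p assume "p \<in> H"
      then have "F p = f p" "p \<in> {j - 3..j + 3}" using j unfolding H_def F_def by auto
      then show "card {l \<in> {..<m}. \<not> fits f {..<m} l (F p)} \<le> m div 16" using flex by simp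
    qed
    show "\<forall>i\<in>{..m} - ({0, 1, 2, m} \<union> {j - 3..j + 3}). F i = f i" unfolding F_def by auto
  qed (use okF cC injF imF assms(3,4) j in \<open>auto simp: H_def\<close>)
  then obtain F' where F': "ok_on F' {..m}" "inj_on F' {..m}" "F' ` {..m} = F ` {..m}" "\<forall>i<3. F' i = F i"
      "\<forall>i\<le>m. \<exists>k\<le>m. F' i = F k \<and> k mod 4 = i mod 4" by blast
  have "F' i = f i" if "i < 3" for i using F'(4) that j unfolding F_def by auto
  moreover have "\<exists>k'\<le>m. F k = (f(m := u)) k' \<and> k' mod 4 = k mod 4" if "k \<le> m" for k
    using that j FT[of k] by (intro exI[of _ "?t k"]) auto
  then have "\<forall>i\<le>m. \<exists>k\<le>m. F' i = (f(m := u)) k \<and> k mod 4 = i mod 4" using F'(5) by metis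
  ultimately show ?thesis using F'(1-3) imF by (intro exI[of _ F'] conjI) auto
qed

lemma ok_on_extend:
  assumes "ok_on f {..<m}" "inj_on f {..<m}" "f ` {..<m} \<subseteq> V" "u \<in> V" "u \<notin> f ` {..<m}" "fits f {..<m} m u"
  shows "\<exists>F. ok_on F {..m} \<and> inj_on F {..m} \<and> F ` {..m} = insert u (f ` {..<m}) \<and> (\<forall>i<m. F i = f i) \<and> F m = u"
proof -
  have m1: "{..m} = insert m {..<m}" by auto
  have "ok_on (f(m := u)) {..m}" unfolding m1 using assms by (intro ok_on_fill)
  moreover have "inj_on (f(m := u)) {..m}" unfolding m1 using assms(2,5)
    by (auto simp: inj_on_def image_iff)
  moreover have "(f(m := u)) ` {..m} = insert u (f ` {..<m})" unfolding m1 by auto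
  ultimately show ?thesis by (intro exI[of _ "f(m := u)"]) auto
qed

lemma ordering_step:
  assumes f: "ok_on f {..<m}" "inj_on f {..<m}" "f ` {3..<m} \<subseteq> U"
      "\<forall>i<m. f i \<in> A \<longleftrightarrow> i mod 4 \<noteq> \<phi>" "f ` {..<3} \<subseteq> V"
    and U: "U \<subseteq> V" "U \<inter> f ` {..<3} = {}" "\<And>u. u \<in> U \<Longrightarrow> {u} \<notin> D" "card U = N"
      "card (U - A) = card {i \<in> {3..<N + 3}. i mod 4 = \<phi>}"
    and N: "50000 * g + 50000 \<le> N" and m: "3 \<le> m" "m < N + 3"
  shows "\<exists>F. ok_on F {..m} \<and> inj_on F {..m} \<and> F ` {3..m} \<subseteq> U \<and> (\<forall>i<3. F i = f i) \<and>
    (\<forall>i\<le>m. F i \<in> A \<longleftrightarrow> i mod 4 \<noteq> \<phi>)"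
proof -
  have finU: "finite U" using U(1) finite_V finite_subset by blast
  define T where "T = {i :: nat. (i mod 4 \<noteq> \<phi>) = (m mod 4 \<noteq> \<phi>)}"
  define UT where "UT = {u \<in> U. (u \<in> A) = (m mod 4 \<noteq> \<phi>)}"
  have split: "{..<m} = {..<3} \<union> {3..<m}" using m by auto
  have imV: "f ` {..<m} \<subseteq> V" using f(3,5) U(1) unfolding split image_Un by blast
  have cUT: "card UT = card ({3..<N + 3} \<inter> T)"
  proof (cases "m mod 4 = \<phi>")
    case True
    then have "UT = U - A" "{3..<N + 3} \<inter> T = {i \<in> {3..<N + 3}. i mod 4 = \<phi>}"
      unfolding UT_def T_def by auto
    then show ?thesis using U(5) by simp
  next
    case False
    then have "UT = U - (U - A)" "{3..<N + 3} \<inter> T = {3..<N + 3} - {i \<in> {3..<N + 3}. i mod 4 = \<phi>}"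
      unfolding UT_def T_def by auto
    moreover have "card (U - (U - A)) = card U - card (U - A)" by (rule card_Diff_subset) (use finU in auto)
    moreover have "card ({3..<N + 3} - {i \<in> {3..<N + 3}. i mod 4 = \<phi>})
       = card {3..<N + 3} - card {i \<in> {3..<N + 3}. i mod 4 = \<phi>}" by (rule card_Diff_subset) auto
    ultimately show ?thesis using U(4,5) by simp
  qed
  define Free where "Free = UT - f ` {..<m}"
  have finFree: "finite Free" unfolding Free_def UT_def using finU by auto
  have cFree: "card ({m..<N + 3} \<inter> T) \<le> card Free"
  proof -
    have "UT \<subseteq> Free \<union> f ` ({3..<m} \<inter> T)"
    proof
      fix u assume u: "u \<in> UT"
      show "u \<in> Free \<union> f ` ({3..<m} \<inter> T)"
      proof (cases "u \<in> f ` {..<m}")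
        case True
        then obtain i where i: "i < m" "u = f i" by auto
        moreover have "i \<ge> 3" using i u U(2) unfolding UT_def by (auto simp: not_le[symmetric])
        moreover have "i \<in> T" using f(4) i u unfolding UT_def T_def by auto
        ultimately show ?thesis by auto
      qed (use u in \<open>auto simp: Free_def\<close>)
    qed
    then have "card UT \<le> card (Free \<union> f ` ({3..<m} \<inter> T))" using finFree by (intro card_mono) auto
    also have "\<dots> \<le> card Free + card (f ` ({3..<m} \<inter> T))" by (rule card_Un_le)
    also have "\<dots> \<le> card Free + card ({3..<m} \<inter> T)" by (intro add_left_mono card_image_le) auto
    finally have 1: "card UT \<le> card Free + card ({3..<m} \<inter> T)" .
    have "{3..<N + 3} \<inter> T = ({3..<m} \<inter> T) \<union> ({m..<N + 3} \<inter> T)" using m by auto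
    then have "card ({3..<N + 3} \<inter> T) = card ({3..<m} \<inter> T) + card ({m..<N + 3} \<inter> T)"
      by (simp only:) (rule card_Un_disjoint, auto)
    then show ?thesis using 1 cUT by linarith
  qed
  have Free: "u \<in> V" "{u} \<notin> D" "u \<notin> f ` {..<m}" "u \<in> U" "(u \<in> A) = (m mod 4 \<noteq> \<phi>)" if "u \<in> Free" for u
    using that U(1,3) unfolding Free_def UT_def by auto
  show ?thesis
  proof (cases "32 * g < card Free")
    case True
    have "finite {z \<in> V. \<not> fits f {..<m} m z}" using finite_V by simp
    then have "\<not> Free \<subseteq> {z \<in> V. \<not> fits f {..<m} m z}"
      using card_not_fits[OF f(1) imV, of m] True by (intro not_subset_of_card_less) linarith+
    then obtain u where u: "u \<in> Free" "fits f {..<m} m u" using Free(1) by blast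
    obtain F where F: "ok_on F {..m}" "inj_on F {..m}" "F ` {..m} = insert u (f ` {..<m})"
        "\<forall>i<m. F i = f i" "F m = u"
      using ok_on_extend[OF f(1,2) imV Free(1)[OF u(1)] Free(3)[OF u(1)] u(2)] by blast
    have "F i \<in> U" if "i \<in> {3..m}" for i
      using that F(4,5) f(3) Free(4)[OF u(1)] by (cases "i = m") auto
    moreover have "F i \<in> A \<longleftrightarrow> i mod 4 \<noteq> \<phi>" if "i \<le> m" for i
      using that F(4,5) f(4) Free(5)[OF u(1)] by (cases "i = m") auto
    ultimately show ?thesis using F m by (intro exI[of _ F]) auto
  next
    case False
    have "(N + 3 - m) div 4 \<le> card {i \<in> {m..<N + 3}. i mod 4 = m mod 4}"
      by (rule card_residue_class)
    also have "\<dots> \<le> card ({m..<N + 3} \<inter> T)" by (rule card_mono) (auto simp: T_def)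
    finally have "(N + 3 - m) div 4 \<le> 32 * g" using cFree False by linarith
    then have "(N + 3 - m) div 4 < 32 * g + 1" by linarith
    then have "N + 3 - m < 4 * (32 * g) + 4" by (subst (asm) div_less_iff_less_mult) auto
    then have "20000 * g + 20000 \<le> m" using N m by linarith
    moreover have "m \<in> {m..<N + 3} \<inter> T" using m by (auto simp: T_def)
    then have "card ({m..<N + 3} \<inter> T) \<noteq> 0" by (subst card_0_eq) auto
    then have "Free \<noteq> {}" using cFree by (metis card.empty le_zero_eq)
    then obtain u where u: "u \<in> Free" by blast
    ultimately obtain F where F: "ok_on F {..m}" "inj_on F {..m}" "F ` {..m} = insert u (f ` {..<m})"
        "\<forall>i<3. F i = f i" "\<forall>i\<le>m. \<exists>k\<le>m. F i = (f(m := u)) k \<and> k mod 4 = i mod 4"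
      using extend_by_swaps[OF f(1,2) imV Free(1-3)[OF u]] by blast
    have "F i \<in> U" if i: "i \<in> {3..m}" for i
    proof -
      have "F i \<in> insert u (f ` {..<m})" using F(3) i by auto
      then consider "F i = u" | k where "k < m" "F i = f k" by auto
      then show ?thesis
      proof cases
        case 2
        have "k \<ge> 3"
        proof (rule ccontr)
          assume "\<not> k \<ge> 3"
          then have "F i = F k" "k \<in> {..m}" "i \<in> {..m}" "k \<noteq> i" using 2 F(4) i by auto
          then show False using inj_onD[OF F(2)] by metis
        qed
        then show ?thesis using 2 f(3) by auto
      qed (use Free(4)[OF u] in simp)
    qed
    moreover have "F i \<in> A \<longleftrightarrow> i mod 4 \<noteq> \<phi>" if "i \<le> m" for i
    proof -
      obtain k where k: "k \<le> m" "F i = (f(m := u)) k" "k mod 4 = i mod 4" using F(5) \<open>i \<le> m\<close> by blast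
      then show ?thesis using f(4) Free(5)[OF u] by (cases "k = m") auto
    qed
    ultimately show ?thesis using F by (intro exI[of _ F]) auto
  qed
qed

lemma ordering_exists:
  assumes t: "ok_on t {..<3}" "inj_on t {..<3}" "t ` {..<3} \<subseteq> V" "\<forall>i<3. t i \<in> A \<longleftrightarrow> i mod 4 \<noteq> \<phi>"
    and U: "U \<subseteq> V" "U \<inter> t ` {..<3} = {}" "\<And>u. u \<in> U \<Longrightarrow> {u} \<notin> D" "card U = N"
      "card (U - A) = card {i \<in> {3..<N + 3}. i mod 4 = \<phi>}"
    and N: "50000 * g + 50000 \<le> N"
  shows "\<exists>F. ok_on F {..<N + 3} \<and> inj_on F {..<N + 3} \<and> F ` {3..<N + 3} = U \<and> (\<forall>i<3. F i = t i) \<and>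
    (\<forall>i<N + 3. F i \<in> A \<longleftrightarrow> i mod 4 \<noteq> \<phi>)"
proof -
  have "\<exists>F. ok_on F {..<k + 3} \<and> inj_on F {..<k + 3} \<and> F ` {3..<k + 3} \<subseteq> U \<and> (\<forall>i<3. F i = t i) \<and>
    (\<forall>i<k + 3. F i \<in> A \<longleftrightarrow> i mod 4 \<noteq> \<phi>)" if "k \<le> N" for k
    using that
  proof (induction k)
    case 0
    then show ?case using t by (intro exI[of _ t]) auto
  next
    case (Suc k)
    then obtain f where f: "ok_on f {..<k + 3}" "inj_on f {..<k + 3}" "f ` {3..<k + 3} \<subseteq> U"
      "\<forall>i<3. f i = t i" "\<forall>i<k + 3. f i \<in> A \<longleftrightarrow> i mod 4 \<noteq> \<phi>" by auto
    have "f ` {..<3} = t ` {..<3}" using f(4) by auto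
    then obtain F where F: "ok_on F {..k + 3}" "inj_on F {..k + 3}" "F ` {3..k + 3} \<subseteq> U" "\<forall>i<3. F i = f i"
      "\<forall>i\<le>k + 3. F i \<in> A \<longleftrightarrow> i mod 4 \<noteq> \<phi>"
      using ordering_step[OF f(1-3,5) _ U(1) _ U(3-5) N, simplified] t(3) U(2) Suc.prems by auto
    have "{..<Suc k + 3} = {..k + 3}" "{3..<Suc k + 3} = {3..k + 3}" by auto
    then show ?case using F f(4) by (intro exI[of _ F]) auto
  qed
  from this[of N] obtain F where F: "ok_on F {..<N + 3}" "inj_on F {..<N + 3}" "F ` {3..<N + 3} \<subseteq> U"
      "\<forall>i<3. F i = t i" "\<forall>i<N + 3. F i \<in> A \<longleftrightarrow> i mod 4 \<noteq> \<phi>" by auto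
  have "inj_on F {3..<N + 3}" using F(2) by (rule inj_on_subset) auto
  then have "card (F ` {3..<N + 3}) = N" by (subst card_image) auto
  then have "F ` {3..<N + 3} = U" using U(1,4) finite_V F(3) finite_subset by (intro card_subset_eq) auto
  then show ?thesis using F by blast
qed

text \<open>Each hole is filled greedily from its own candidate set: at most
  \<open>card P + card H\<close> vertices are in use, and at most \<open>32 * g\<close> do not
  fit.\<close>

lemma fill_holes:
  assumes "finite H" "finite P" "ok_on f P" "inj_on f P" "f ` P \<subseteq> V" "H \<inter> P = {}"
    and "\<And>p. p \<in> H \<Longrightarrow> X p \<subseteq> V \<and> card P + card H + 32 * g < card (X p)"
  shows "\<exists>F. (\<forall>i\<in>P. F i = f i) \<and> (\<forall>p\<in>H. F p \<in> X p) \<and> inj_on F (P \<union> H) \<and> ok_on F (P \<union> H)"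
  using assms(1,6,7)
proof (induction H)
  case empty
  then show ?case using assms by (intro exI[of _ f]) auto
next
  case (insert p H)
  have "X q \<subseteq> V \<and> card P + card H + 32 * g < card (X q)" if "q \<in> H" for q
    using insert.prems(2)[of q] that insert.hyps by auto
  then obtain F where F: "\<forall>i\<in>P. F i = f i" "\<forall>p\<in>H. F p \<in> X p" "inj_on F (P \<union> H)" "ok_on F (P \<union> H)"
    using insert.IH insert.prems(1) by auto
  have X: "X p \<subseteq> V" "card P + card H + 32 * g < card (X p)" using insert.prems(2)[of p] insert.hyps by auto
  have "F q \<in> V" if "q \<in> H" for q using F(2) insert.prems(2)[of q] that by blast
  then have FV: "F ` (P \<union> H) \<subseteq> V" using F(1) assms(5) by auto
  let ?Bd = "{z \<in> V. \<not> fits F (P \<union> H) p z} \<union> F ` (P \<union> H)"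
  have "card (F ` (P \<union> H)) \<le> card P + card H"
    using card_image_le[of "P \<union> H" F] card_Un_le[of P H] assms(2) insert.hyps(1) by fastforce
  then have "card ?Bd \<le> 32 * g + (card P + card H)"
    using card_not_fits[OF F(4) FV, of p] by (intro order_trans[OF card_Un_le] add_mono) auto
  then have "card ?Bd < card (X p)" using X by linarith
  moreover have "finite ?Bd" using finite_V assms(2) insert.hyps(1) by auto
  ultimately have "\<not> X p \<subseteq> ?Bd" by (intro not_subset_of_card_less)
  then obtain z where z: "z \<in> X p" "z \<notin> ?Bd" by blast
  then have fz: "fits F (P \<union> H) p z" using X by blast
  have un: "P \<union> insert p H = insert p (P \<union> H)" by auto
  have pPH: "p \<notin> P \<union> H" using insert.hyps insert.prems by auto
  have "ok_on (F(p := z)) (P \<union> insert p H)" unfolding un by (rule ok_on_fill[OF F(4) fz])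
  moreover have "inj_on (F(p := z)) (P \<union> insert p H)" unfolding un using F(3) z(2) pPH
    by (auto simp: inj_on_def image_iff)
  moreover have "(\<forall>i\<in>P. (F(p := z)) i = f i) \<and> (\<forall>q\<in>insert p H. (F(p := z)) q \<in> X q)"
    using F(1,2) z(1) pPH by auto
  ultimately show ?case by blast
qed

end

section \<open>Tight paths with a periodic pattern\<close>

definition tight :: "'a set set \<Rightarrow> 'a list \<Rightarrow> bool" where
  "tight E xs \<longleftrightarrow> (\<forall>i. i + 3 < length xs \<longrightarrow> {xs ! i, xs ! (i + 1), xs ! (i + 2), xs ! (i + 3)} \<in> E)"

text \<open>An overlap of three vertices ensures that each window of four lies in
  \<open>xs @ ys\<close> or in \<open>ys @ zs\<close>.\<close>

lemma tight_append:
  assumes "tight E (xs @ ys)" "tight E (ys @ zs)" "length ys \<ge> 3"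
  shows "tight E (xs @ ys @ zs)"
  unfolding tight_def
proof (intro allI impI)
  let ?w = "\<lambda>xs i. {xs ! i, xs ! (i + 1), xs ! (i + 2), xs ! (i + 3)}"
  fix i assume i: "i + 3 < length (xs @ ys @ zs)"
  show "?w (xs @ ys @ zs) i \<in> E"
  proof (cases "i < length xs")
    case True
    have "(xs @ ys @ zs) ! (i + k) = (xs @ ys) ! (i + k)" if "k \<le> 3" for k
      using True that assms(3) unfolding append_assoc[symmetric] nth_append by simp
    from this[of 0] this[of 1] this[of 2] this[of 3] have "?w (xs @ ys @ zs) i = ?w (xs @ ys) i" by simp
    then show ?thesis using assms(1,3) True unfolding tight_def by simp
  next
    case False
    have "(xs @ ys @ zs) ! (i + k) = (ys @ zs) ! (i - length xs + k)" for k
      using False unfolding nth_append[of xs] by simp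
    from this[of 0] this[of 1] this[of 2] this[of 3]
    have "?w (xs @ ys @ zs) i = ?w (ys @ zs) (i - length xs)" by simp
    moreover have "i - length xs + 3 < length (ys @ zs)" using False i by simp
    ultimately show ?thesis using assms(2) unfolding tight_def by metis
  qed
qed

lemma tight_rev:
  assumes "tight E xs" shows "tight E (rev xs)"
  unfolding tight_def
proof (intro allI impI)
  fix i assume i: "i + 3 < length (rev xs)"
  define j where "j = length xs - 4 - i"
  have "rev xs ! i = xs ! (j + 3)" "rev xs ! (i + 1) = xs ! (j + 2)" "rev xs ! (i + 2) = xs ! (j + 1)"
     "rev xs ! (i + 3) = xs ! j"
    using i unfolding j_def by (simp_all add: rev_nth, (intro arg_cong[of _ _ "nth xs"], simp)+)
  moreover have "{xs ! j, xs ! (j + 1), xs ! (j + 2), xs ! (j + 3)} \<in> E"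
    using assms[unfolded tight_def, rule_format, of j] i unfolding j_def by fastforce
  ultimately show "{rev xs ! i, rev xs ! (i + 1), rev xs ! (i + 2), rev xs ! (i + 3)} \<in> E"
    by (simp add: insert_commute)
qed

lemma tight_Cons:
  "tight E (a # b # c # d # xs) \<longleftrightarrow> {a, b, c, d} \<in> E \<and> tight E (b # c # d # xs)"
proof
  assume L: "tight E (a # b # c # d # xs)"
  have "{a, b, c, d} \<in> E" using L[unfolded tight_def, rule_format, of 0] by (simp add: numeral_2_eq_2 numeral_3_eq_3)
  moreover have "tight E (b # c # d # xs)" unfolding tight_def
  proof (intro allI impI)
    fix i assume "i + 3 < length (b # c # d # xs)"
    then show "{(b # c # d # xs) ! i, (b # c # d # xs) ! (i + 1), (b # c # d # xs) ! (i + 2), (b # c # d # xs) ! (i + 3)} \<in> E"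
      using L[unfolded tight_def, rule_format, of "i + 1"] by (simp add: numeral_2_eq_2 numeral_3_eq_3)
  qed
  ultimately show "{a, b, c, d} \<in> E \<and> tight E (b # c # d # xs)" ..
next
  assume R: "{a, b, c, d} \<in> E \<and> tight E (b # c # d # xs)"
  have "tight E ([a] @ [b, c, d] @ xs)"
  proof (rule tight_append)
    show "tight E ([a] @ [b, c, d])" using R unfolding tight_def
      by (auto simp: less_Suc_eq numeral_2_eq_2 numeral_3_eq_3)
  qed (use R in auto)
  then show "tight E (a # b # c # d # xs)" by simp
qed

lemma tight_short: "length xs \<le> 3 \<Longrightarrow> tight E xs"
  unfolding tight_def by auto

lemma mod_4_unique:
  fixes i j k :: nat
  assumes "j \<in> {i..i + 3}" "k \<in> {i..i + 3}" "j mod 4 = k mod 4"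
  shows "j = k"
proof (rule ccontr)
  assume "j \<noteq> k"
  then have "max j k - min j k < 4" "max j k - min j k > 0" using assms(1,2) by auto
  moreover have "4 dvd max j k - min j k"
    using assms(3) by (subst mod_eq_dvd_iff_nat[symmetric]) (auto simp: max_def min_def)
  ultimately show False using nat_dvd_not_less by blast
qed

text \<open>\<open>\<phi>\<close> is the position of the one vertex outside \<open>A\<close>; \<open>\<phi> = 3\<close> means that all three vertices lie in \<open>A\<close>.\<close>

definition end_type :: "'a set \<Rightarrow> nat \<Rightarrow> 'a list \<Rightarrow> bool" where
  "end_type A \<phi> ts \<longleftrightarrow> \<phi> < 4 \<and> (\<forall>i<3. ts ! i \<in> A \<longleftrightarrow> i \<noteq> \<phi>)"

context bad_sets
begin

text \<open>Such a triple is a stretch of the AAAB pattern in some phase, as at most one of its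
  vertices lies outside \<open>A\<close>. This is the interface between all path
  constructions.\<close>

definition good_end :: "'a set \<Rightarrow> 'a list \<Rightarrow> bool" where
  "good_end A ts \<longleftrightarrow> length ts = 3 \<and> distinct ts \<and> set ts \<subseteq> V \<and> ok (set ts) \<and> (\<exists>\<phi>. end_type A \<phi> ts)"

lemma good_endI:
  assumes "ok {x, y, z}" "x \<in> V" "y \<in> V" "z \<in> V" "distinct [x, y, z]"
    "x \<in> A \<and> y \<in> A \<or> x \<in> A \<and> z \<in> A \<or> y \<in> A \<and> z \<in> A"
  shows "good_end A [x, y, z]"
proof -
  have "end_type A (if x \<notin> A then 0 else if y \<notin> A then 1 else if z \<notin> A then 2 else 3) [x, y, z]"
    using assms(6) unfolding end_type_def by (auto simp: less_Suc_eq numeral_3_eq_3)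
  then show ?thesis using assms unfolding good_end_def by auto
qed

lemma good_end_rev:
  assumes "good_end A ts" shows "good_end A (rev ts)"
proof -
  obtain x y z where ts: "ts = [x, y, z]"
    using assms unfolding good_end_def by (auto simp: length_Suc_conv numeral_3_eq_3)
  obtain p where "end_type A p ts" using assms unfolding good_end_def by blast
  then have "(x \<in> A \<longleftrightarrow> p \<noteq> 0) \<and> (y \<in> A \<longleftrightarrow> p \<noteq> 1) \<and> (z \<in> A \<longleftrightarrow> p \<noteq> 2)"
    unfolding end_type_def ts by (metis (no_types, lifting) One_nat_def lessI less_2_cases_iff less_SucI nth_Cons_0 nth_Cons_Suc numeral_2_eq_2 numeral_3_eq_3)
  then show ?thesis using assms ts unfolding good_end_def[of A ts]
    by (auto intro!: good_endI simp: insert_commute)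
qed

end

text \<open>Odd intersection with \<open>A\<close> covers the types AAAB and ABBB at once. For a
  4-set it is equivalent to odd intersection with \<open>B\<close>, so the locale is symmetric and
  every result holds for both ends. The degree condition is written with \<open>+ 1\<close> to avoid
  truncated subtraction.\<close>

locale near_extremal = bad_sets V D g
  for V :: "'a set" and D g +
  fixes A B :: "'a set" and E :: "'a set set" and n :: nat
  assumes union: "A \<union> B = V" and disj: "A \<inter> B = {}" and card_A: "card A = n" and card_B: "card B = n"
    and codegree: "T \<subseteq> V \<Longrightarrow> card T = 3 \<Longrightarrow> n \<le> card {x \<in> V. insert x T \<in> E} + 1"
    and card_edge: "e \<in> E \<Longrightarrow> card e = 4"
    and odd_edge: "e \<subseteq> V \<Longrightarrow> card e = 4 \<Longrightarrow> odd (card (e \<inter> A)) \<Longrightarrow> e \<notin> D \<Longrightarrow> e \<in> E"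
    and large: "1000000 * g + 1000000 \<le> n"
begin

lemma finite_A: "finite A" and finite_B: "finite B"
  using finite_V union by auto

lemma swap: "near_extremal V D g B A E n"
proof unfold_locales
  fix e assume e: "e \<subseteq> V" "card e = 4" "odd (card (e \<inter> B))" "e \<notin> D"
  have "finite e" using e(2) card.infinite by fastforce
  moreover have "e = (e \<inter> A) \<union> (e \<inter> B)" using e(1) union by auto
  moreover have "(e \<inter> A) \<inter> (e \<inter> B) = {}" using disj by auto
  ultimately have "card e = card (e \<inter> A) + card (e \<inter> B)" by (metis card_Un_disjoint finite_Int)
  then have "odd (card (e \<inter> A))" using e(2,3) by presburger
  then show "e \<in> E" using e odd_edge by blast
qed (use union disj card_A card_B codegree card_edge large in auto)

lemma pattern_tight:
  assumes F: "inj_on F {..<M}" "F ` {..<M} \<subseteq> V" "ok_on F {..<M}" "\<forall>i<M. F i \<in> A \<longleftrightarrow> i mod 4 \<noteq> \<phi>"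
    and "\<phi> < 4"
  shows "tight E (map F [0..<M])"
  unfolding tight_def
proof (intro allI impI)
  fix i assume i: "i + 3 < length (map F [0..<M])"
  then have sub: "{i..i + 3} \<subseteq> {..<M}" by auto
  let ?e = "F ` {i..i + 3}"
  have I4: "{i..i + 3} = {i, i + 1, i + 2, i + 3}" by auto
  have "inj_on F {i..i + 3}" using F(1) sub by (rule inj_on_subset)
  then have ce: "card ?e = 4" by (subst card_image) auto
  \<comment> \<open>\<open>3 * i\<close> stands for \<open>- i\<close> mod 4, so \<open>b\<close> is
    the unique position of the window in the residue class of \<open>\<phi>\<close>.\<close>
  define b where "b = i + (\<phi> + 3 * i) mod 4"
  have "(\<phi> + 3 * i) mod 4 < 4" by simp
  then have b1: "b \<in> {i..i + 3}" unfolding b_def by simp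
  have b2: "b mod 4 = \<phi>" unfolding b_def using \<open>\<phi> < 4\<close> by presburger
  note b = b1 b2
  have ub: "k = b" if "k \<in> {i..i + 3}" "k mod 4 = \<phi>" for k
    using that b mod_4_unique by auto
  have "?e \<inter> A = ?e - {F b}"
  proof (rule set_eqI)
    fix z
    have "F k \<in> A \<longleftrightarrow> F k \<noteq> F b" if k: "k \<in> {i..i + 3}" for k
    proof -
      have "F k \<in> A \<longleftrightarrow> k \<noteq> b" using F(4) sub k b ub by blast
      moreover have "k \<noteq> b \<longleftrightarrow> F k \<noteq> F b" using \<open>inj_on F {i..i + 3}\<close> k b(1) by (auto dest: inj_onD)
      ultimately show ?thesis by simp
    qed
    from this show "z \<in> ?e \<inter> A \<longleftrightarrow> z \<in> ?e - {F b}"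
      unfolding Int_iff Diff_iff image_iff singleton_iff by metis
  qed
  moreover have "F b \<in> ?e" using b(1) by blast
  ultimately have "card (?e \<inter> A) = 3" using ce by (simp add: card_Diff_singleton)
  then have "odd (card (?e \<inter> A))" by simp
  moreover have "?e \<subseteq> V" using F(2) sub by blast
  moreover have "{..<M} \<inter> {i..i + 3} = {i..i + 3}" using sub by blast
  then have "ok ?e" using F(3) unfolding ok_on_def by metis
  then have "?e \<notin> D" unfolding ok_def by blast
  ultimately have "?e \<in> E" using odd_edge ce by blast
  moreover have "?e = {F i, F (i + 1), F (i + 2), F (i + 3)}" unfolding I4 by auto
  ultimately show "{map F [0..<M] ! i, map F [0..<M] ! (i + 1), map F [0..<M] ! (i + 2), map F [0..<M] ! (i + 3)} \<in> E"
    using i by simp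
qed

lemma ok_on_end:
  assumes "length ts = 3" "ok (set ts)"
  shows "ok_on ((!) ts) {..<3}"
  unfolding ok_on_def
proof
  fix i
  have "(!) ts ` ({..<3} \<inter> {i..i + 3}) \<subseteq> set ts" using assms(1) by auto
  then show "ok ((!) ts ` ({..<3} \<inter> {i..i + 3}))" using assms(2) ok_mono by blast
qed

lemma extend_end:
  assumes ts: "good_end A ts" "end_type A \<phi> ts"
    and U: "U \<subseteq> V" "U \<inter> set ts = {}" "\<And>u. u \<in> U \<Longrightarrow> {u} \<notin> D" "card U = N"
      "card (U - A) = card {i \<in> {3..<N + 3}. i mod 4 = \<phi>}"
    and N: "50000 * g + 50000 \<le> N"
  obtains us where "set us = U" "distinct (ts @ us)" "tight E (ts @ us)"
proof -
  have l3: "length ts = 3" "distinct ts" using ts(1) unfolding good_end_def by auto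
  have im: "(!) ts ` {..<3} = set ts" using l3(1) by (auto simp: set_conv_nth)
  have "\<forall>i<3. (ts ! i \<in> A) = (i mod 4 \<noteq> \<phi>)"
    using ts(2) unfolding end_type_def by auto
  moreover have "inj_on ((!) ts) {..<3}" using l3 by (auto simp: inj_on_def nth_eq_iff_index_eq)
  moreover have "ok_on ((!) ts) {..<3}" using ok_on_end ts(1) unfolding good_end_def by blast
  moreover have "set ts \<subseteq> V" using ts(1) unfolding good_end_def by blast
  ultimately obtain F where F: "ok_on F {..<N + 3}" "inj_on F {..<N + 3}" "F ` {3..<N + 3} = U" "\<forall>i<3. F i = ts ! i"
    "\<forall>i<N + 3. F i \<in> A \<longleftrightarrow> i mod 4 \<noteq> \<phi>"
    using ordering_exists[of "(!) ts" A \<phi> U N] U N unfolding im by auto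
  define us where "us = map F [3..<N + 3]"
  have "[0..<N + 3] = [0..<3] @ [3..<N + 3]" using upt_add_eq_append[of 0 3 N] by (simp add: add.commute)
  moreover have "map F [0..<3] = ts" using l3(1) F(4) by (intro nth_equalityI) auto
  ultimately have eq: "map F [0..<N + 3] = ts @ us" unfolding us_def by simp
  have "F ` {..<N + 3} \<subseteq> V"
  proof -
    have "set (ts @ us) \<subseteq> V" using \<open>set ts \<subseteq> V\<close> U(1) F(3) unfolding us_def by auto
    then show ?thesis unfolding eq[symmetric] by (auto simp: atLeast0LessThan)
  qed
  then have "tight E (ts @ us)" using pattern_tight[OF F(2) _ F(1,5)] ts(2) unfolding eq end_type_def by blast
  moreover have "distinct (ts @ us)" unfolding eq[symmetric] using F(2) by (simp add: distinct_map atLeast0LessThan)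
  moreover have "set us = U" unfolding us_def using F(3) by simp
  ultimately show ?thesis using that by blast
qed

lemma connect:
  assumes ts: "good_end A ts" and ss: "good_end A ss" and "set ts \<inter> set ss = {}"
    and Fs: "finite Fs" "card Fs + 12 + 32 * g < n"
  obtains cs where "length cs \<le> 6" "distinct (ts @ cs @ ss)" "set cs \<subseteq> V" "set cs \<inter> Fs = {}" "tight E (ts @ cs @ ss)"
proof -
  obtain p q where p: "end_type A p ts" and q: "end_type A q ss" using ts ss unfolding good_end_def by blast
  have l3: "length ts = 3" "distinct ts" "length ss = 3" "distinct ss" using ts ss unfolding good_end_def by auto
  have "p < 4" using p unfolding end_type_def by blast
  \<comment> \<open>Solves \<open>k + 3 + q\<close> congruent to \<open>p\<close> mod 4, so that
    \<open>ss\<close> continues the pattern in the phase of \<open>ts\<close>; the summand 2 is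
    \<open>- 6\<close> mod 4. At least three connecting vertices keep \<open>ts\<close> and
    \<open>ss\<close> out of common windows.\<close>
  define k where "k = 3 + (p + 3 * q + 2) mod 4"
  have "(p + 3 * q + 2) mod 4 < 4" by simp
  then have k12: "3 \<le> k" "k \<le> 6" unfolding k_def by auto
  have "(k + 3 + q) mod 4 = ((6 + q) + (p + 3 * q + 2) mod 4) mod 4" unfolding k_def by (simp add: algebra_simps)
  also have "\<dots> = ((6 + q) + (p + 3 * q + 2)) mod 4" by (rule mod_add_right_eq)
  also have "(6 + q) + (p + 3 * q + 2) = p + 4 * (q + 2)" by simp
  also have "(p + 4 * (q + 2)) mod 4 = p" using \<open>p < 4\<close> by (simp only: mod_mult_self2 mod_less)
  finally have "(k + 3 + q) mod 4 = p" .
  note k = k12 this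
  define f where "f i = (if i < 3 then ts ! i else ss ! (i - (k + 3)))" for i
  define P where "P = {..<3} \<union> {k + 3..<k + 6}"
  define H where "H = {3..<k + 3}"
  define X where "X i = (if i mod 4 \<noteq> p then A else B) - Fs" for i
  have cX: "n - card Fs \<le> card (X i)" for i
    using diff_card_le_card_Diff[OF Fs(1), of A] diff_card_le_card_Diff[OF Fs(1), of B] card_A card_B
    unfolding X_def by (simp split: if_splits)
  have fts: "f i \<in> set ts" if "i < 3" for i using that l3 unfolding f_def by auto
  have fss: "f i \<in> set ss" if "i \<in> {k + 3..<k + 6}" for i using that l3 k unfolding f_def by auto
  have okP: "ok_on f P" unfolding ok_on_def
  proof
    fix i
    have "f ` (P \<inter> {i..i + 3}) \<subseteq> set ts \<or> f ` (P \<inter> {i..i + 3}) \<subseteq> set ss"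
    proof (cases "i < 3")
      case True
      then have "P \<inter> {i..i + 3} \<subseteq> {..<3}" unfolding P_def using k by auto
      then show ?thesis using fts by blast
    next
      case False
      then have "P \<inter> {i..i + 3} \<subseteq> {k + 3..<k + 6}" unfolding P_def using k by auto
      then show ?thesis using fss by blast
    qed
    then show "ok (f ` (P \<inter> {i..i + 3}))" using ts ss ok_mono unfolding good_end_def by blast
  qed
  have injP: "inj_on f P"
  proof -
    have "inj_on f {..<3}" using l3 unfolding f_def by (auto simp: inj_on_def nth_eq_iff_index_eq)
    moreover have "inj_on f {k + 3..<k + 6}" using l3 k unfolding f_def by (auto simp: inj_on_def nth_eq_iff_index_eq)
    moreover have "f ` {..<3} \<subseteq> set ts" "f ` {k + 3..<k + 6} \<subseteq> set ss" using fts fss by auto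
    then have "f ` {..<3} \<inter> f ` {k + 3..<k + 6} = {}" using assms(3) by blast
    ultimately show ?thesis unfolding P_def by (auto simp: inj_on_Un)
  qed
  have fV: "f ` P \<subseteq> V" using fts fss ts ss unfolding P_def good_end_def by blast
  have "card P \<le> 6" unfolding P_def by (rule order_trans[OF card_Un_le]) auto
  moreover have "card H \<le> 6" unfolding H_def using k by auto
  ultimately have room: "X i \<subseteq> V \<and> card P + card H + 32 * g < card (X i)" for i
    using cX[of i] Fs(2) union unfolding X_def by auto
  have "finite H" "finite P" "H \<inter> P = {}" unfolding H_def P_def by auto
  then obtain F where F: "\<forall>i\<in>P. F i = f i" "\<forall>i\<in>H. F i \<in> X i" "inj_on F (P \<union> H)" "ok_on F (P \<union> H)"
    using fill_holes[of H P f X] okP injP fV room by blast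
  have PH: "P \<union> H = {..<k + 6}" unfolding P_def H_def by auto
  have types: "F i \<in> A \<longleftrightarrow> i mod 4 \<noteq> p" if i: "i < k + 6" for i
  proof -
    consider "i < 3" | "i \<in> H" | j where "i = k + 3 + j" "j < 3"
    proof -
      have "i \<ge> k + 3 \<Longrightarrow> i = k + 3 + (i - (k + 3)) \<and> i - (k + 3) < 3" using i by auto
      then show thesis using that unfolding H_def by (metis atLeastLessThan_iff not_le)
    qed
    then show ?thesis
    proof cases
      case 1
      then show ?thesis using F(1) p unfolding P_def f_def end_type_def by auto
    next
      case 2
      then show ?thesis using F(2) disj unfolding X_def by (fastforce split: if_splits)
    next
      case 3
      have "F i = ss ! j" using F(1) 3 unfolding P_def f_def by auto
      then have "F i \<in> A \<longleftrightarrow> j \<noteq> q" using q 3 unfolding end_type_def by auto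
      moreover have "q < 4" using q unfolding end_type_def by blast
      then have "k + 3 + j = k + 3 + q" if "(k + 3 + j) mod 4 = p"
        using that k(3) 3(2) mod_4_unique[of "k + 3 + j" "k + 3" "k + 3 + q"] by auto
      then have "j = q \<longleftrightarrow> (k + 3 + j) mod 4 = p" using k(3) by auto
      ultimately show ?thesis using 3 by auto
    qed
  qed
  have FV: "F i \<in> V" if i: "i < k + 6" for i
  proof (cases "i \<in> P")
    case True
    then show ?thesis using F(1) fV by auto
  next
    case False
    then have "F i \<in> X i" using F(2) i PH by blast
    then show ?thesis using room by blast
  qed
  define cs where "cs = map F [3..<k + 3]"
  have "[0..<k + 6] = [0..<3] @ [3..<k + 3] @ [k + 3..<k + 6]"
    using upt_add_eq_append[of 0 3 "k + 3"] upt_add_eq_append[of 3 "k + 3" 3] by (simp add: add.commute)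
  moreover have "map F [0..<3] = ts" using l3 F(1) by (intro nth_equalityI) (auto simp: P_def f_def)
  moreover have "map F [k + 3..<k + 6] = ss" using l3 F(1) by (intro nth_equalityI) (auto simp: P_def f_def)
  ultimately have eq: "map F [0..<k + 6] = ts @ cs @ ss" unfolding cs_def by simp
  have "tight E (ts @ cs @ ss)" unfolding eq[symmetric]
    by (rule pattern_tight[where \<phi> = p]) (use F(3,4) types FV \<open>p < 4\<close> in \<open>auto simp: PH\<close>)
  moreover have "distinct (ts @ cs @ ss)" unfolding eq[symmetric]
    using F(3) PH by (simp add: distinct_map atLeast0LessThan)
  moreover have "set cs \<subseteq> V" using FV unfolding cs_def by auto
  moreover have "set cs \<inter> Fs = {}" using F(2) unfolding cs_def H_def X_def by auto
  moreover have "length cs \<le> 6" using k unfolding cs_def by simp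
  ultimately show ?thesis using that by blast
qed

end

section \<open>Inserting an arbitrary vertex\<close>

context bad_sets
begin

text \<open>Both flanks are ends for the same part, so one can be joined to the path while the other
  becomes its new end. Only the flanks are subject to \<open>ok\<close>, hence \<open>v\<close> may
  be atypical.\<close>

definition insertable :: "'a set set \<Rightarrow> 'a set \<Rightarrow> 'a \<Rightarrow> 'a set \<Rightarrow> bool" where
  "insertable E A v F \<longleftrightarrow> (\<exists>xs ys. good_end A xs \<and> good_end A ys \<and> distinct (xs @ v # ys) \<and>
     set (xs @ ys) \<inter> F = {} \<and> tight E (xs @ v # ys))"

definition bridge :: "'a set set \<Rightarrow> 'a set \<Rightarrow> 'a set \<Rightarrow> 'a list \<Rightarrow> bool" where
  "bridge E A B Q \<longleftrightarrow> distinct Q \<and> set Q \<subseteq> V \<and> tight E Q \<and>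
     (\<exists>ts ms ss. Q = ts @ ms @ ss \<and> good_end A ts \<and> good_end B ss)"

lemma bridge_rev:
  assumes "bridge E A B Q"
  shows "bridge E B A (rev Q)"
proof -
  obtain ts ms ss where Q: "Q = ts @ ms @ ss" "good_end A ts" "good_end B ss"
    using assms unfolding bridge_def by blast
  then have "rev Q = rev ss @ rev ms @ rev ts" by simp
  then show ?thesis using assms Q(2,3) good_end_rev tight_rev unfolding bridge_def
    by (metis distinct_rev set_rev)
qed

end

lemma tight_3: "tight E [x, y, z]"
  by (rule tight_short) simp

context near_extremal
begin

definition nb :: "'a set \<Rightarrow> 'a set" where
  "nb T = {x \<in> V. insert x T \<in> E}"

lemma nb_subset: "nb T \<subseteq> V" unfolding nb_def by blast

lemma nbD: "x \<in> nb T \<Longrightarrow> insert x T \<in> E" unfolding nb_def by blast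

lemma nb_notin: "x \<in> nb T \<Longrightarrow> card T = 3 \<Longrightarrow> x \<notin> T"
  using card_edge[of "insert x T"] unfolding nb_def by (auto simp: insert_absorb)

lemma card_nb:
  assumes "x \<in> V" "y \<in> V" "z \<in> V" "distinct [x, y, z]"
  shows "n \<le> card (nb {x, y, z}) + 1" "n \<le> card (nb {x, y, z} \<inter> A) + card (nb {x, y, z} \<inter> B) + 1"
proof -
  show 1: "n \<le> card (nb {x, y, z}) + 1"
    using codegree[of "{x, y, z}"] assms unfolding nb_def by auto
  have "nb {x, y, z} = (nb {x, y, z} \<inter> A) \<union> (nb {x, y, z} \<inter> B)" using nb_subset union by blast
  then have "card (nb {x, y, z}) \<le> card (nb {x, y, z} \<inter> A) + card (nb {x, y, z} \<inter> B)"
    by (metis card_Un_le)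
  then show "n \<le> card (nb {x, y, z} \<inter> A) + card (nb {x, y, z} \<inter> B) + 1" using 1 by linarith
qed

lemma pick:
  assumes "X \<subseteq> V" "n \<le> 50 * card X" "finite F" "1000 * card F \<le> n" "length gs \<le> 10"
    and "W \<subseteq> V" "card W \<le> 3" "ok W"
  obtains z where "z \<in> X" "z \<in> V" "z \<notin> F" "z \<notin> set gs" "ok (insert z W)"
proof -
  have "card (F \<union> set gs) \<le> card F + 10"
    using card_Un_le[of F "set gs"] card_length[of gs] assms(5) by linarith
  then have "card (F \<union> set gs) + 8 * g < card X" using assms(2,4) large by linarith
  then obtain z where "z \<in> X" "z \<notin> F \<union> set gs" "ok (insert z W)"
    using pick_ok[of W X "F \<union> set gs"] assms by blast
  then show ?thesis using that assms(1) by blast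
qed

lemma in_V: "x \<in> A \<Longrightarrow> x \<in> V" "x \<in> B \<Longrightarrow> x \<in> V"
  using union by auto

lemma card_nb_dense:
  assumes "x \<in> V" "y \<in> V" "z \<in> V" "distinct [x, y, z]"
  shows "n \<le> 50 * card (nb {x, y, z})"
    "\<not> n \<le> 50 * card (nb {x, y, z} \<inter> A) \<Longrightarrow> n \<le> 50 * card (nb {x, y, z} \<inter> B)"
  using card_nb[OF assms] large by linarith+

text \<open>The segment is \<open>x' x a v a' y y'\<close>, with \<open>x\<close> and
  \<open>y\<close> among the neighbours of \<open>v, a, a'\<close> in \<open>A\<close>. Each flank
  then has two vertices in \<open>A\<close>, so the outermost ones may lie in either part.\<close>

lemma insert_between_AA:
  assumes v: "v \<in> V" and a: "a \<in> A" "a' \<in> A" "a \<noteq> a'" "a \<noteq> v" "a' \<noteq> v" "a \<notin> F" "a' \<notin> F" "{a} \<notin> D" "{a'} \<notin> D"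
    and F: "finite F" "1000 * card F \<le> n" and nb: "n \<le> 50 * card (nb {v, a, a'} \<inter> A)"
  shows "insertable E A v F"
proof -
  have aV: "a \<in> V" "a' \<in> V" using a in_V by auto
  have sub: "nb {v, a, a'} \<inter> A \<subseteq> V" using nb_subset by blast
  obtain x where x: "x \<in> nb {v, a, a'} \<inter> A" "x \<in> V" "x \<notin> F" "x \<notin> set [v, a, a']" "ok {x, a}"
    using pick[OF sub nb F, of "[v, a, a']" "{a}"] aV ok_singleton a by auto
  obtain y where y: "y \<in> nb {v, a, a'} \<inter> A" "y \<in> V" "y \<notin> F" "y \<notin> set [v, a, a', x]" "ok {y, a'}"
    using pick[OF sub nb F, of "[v, a, a', x]" "{a'}"] aV ok_singleton a by auto
  have "n \<le> 50 * card (nb {v, a, x})" using card_nb_dense v aV x a by auto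
  then obtain x' where x': "x' \<in> nb {v, a, x}" "x' \<in> V" "x' \<notin> F" "x' \<notin> set [v, a, a', x, y]" "ok {x', x, a}"
    using pick[OF nb_subset _ F, of _ "[v, a, a', x, y]" "{x, a}"] aV x by (auto simp: card_insert_if)
  have "n \<le> 50 * card (nb {v, a', y})" using card_nb_dense v aV y a by auto
  then obtain y' where y': "y' \<in> nb {v, a', y}" "y' \<in> V" "y' \<notin> F" "y' \<notin> set [v, a, a', x, y, x']" "ok {y', y, a'}"
    using pick[OF nb_subset _ F, of _ "[v, a, a', x, y, x']" "{y, a'}"] aV y by (auto simp: card_insert_if)
  have "good_end A [x', x, a]" using x' x aV a by (intro good_endI) auto
  moreover have "good_end A [a', y, y']" using y' y aV a by (intro good_endI) (auto simp: insert_commute)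
  moreover have "distinct ([x', x, a] @ v # [a', y, y'])" using x x' y y' a by auto
  moreover have "set ([x', x, a] @ [a', y, y']) \<inter> F = {}" using x x' y y' a by auto
  moreover have "tight E ([x', x, a] @ v # [a', y, y'])"
    using nbD[OF x'(1)] nbD[OF y'(1)] nbD[of x "{v, a, a'}"] nbD[of y "{v, a, a'}"] x(1) y(1)
    by (simp add: tight_Cons tight_3 insert_commute)
  ultimately show ?thesis unfolding insertable_def by blast
qed

text \<open>The segment is \<open>x b a v a' b' y\<close>. Here the inner windows use the neighbours
  \<open>b, b'\<close> of \<open>v, a, a'\<close>, and \<open>x\<close>, \<open>y\<close> in
  \<open>A\<close> make up for them in the flanks.\<close>

lemma insert_between_BAAB:
  assumes v: "v \<in> V" and a: "a \<in> A" "a' \<in> A" "a \<noteq> a'" "a \<noteq> v" "a' \<noteq> v" "a \<notin> F" "a' \<notin> F"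
    and b: "b \<in> V" "b' \<in> V" "b \<noteq> b'" "b \<notin> {v, a, a'}" "b' \<notin> {v, a, a'}" "b \<notin> F" "b' \<notin> F" "ok {a, b}" "ok {a', b'}"
      "b \<in> nb {v, a, a'}" "b' \<in> nb {v, a, a'}"
    and F: "finite F" "1000 * card F \<le> n"
    and nb: "n \<le> 50 * card (nb {v, a, b} \<inter> A)" "n \<le> 50 * card (nb {v, a', b'} \<inter> A)"
  shows "insertable E A v F"
proof -
  have aV: "a \<in> V" "a' \<in> V" using a in_V by auto
  have sub: "nb T \<inter> A \<subseteq> V" for T using nb_subset by blast
  have pairs: "{a, b} \<subseteq> V" "{a', b'} \<subseteq> V" "card {a, b} \<le> 3" "card {a', b'} \<le> 3"
    using aV b by (auto simp: card_insert_if)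
  obtain x where x: "x \<in> nb {v, a, b} \<inter> A" "x \<in> V" "x \<notin> F" "x \<notin> set [v, a, a', b, b']" "ok {x, a, b}"
    using pick[OF sub nb(1) F _ pairs(1,3) b(8), of "[v, a, a', b, b']"] by auto
  obtain y where y: "y \<in> nb {v, a', b'} \<inter> A" "y \<in> V" "y \<notin> F" "y \<notin> set [v, a, a', b, b', x]" "ok {y, a', b'}"
    using pick[OF sub nb(2) F _ pairs(2,4) b(9), of "[v, a, a', b, b', x]"] by auto
  have "good_end A [x, b, a]" using x b aV a by (intro good_endI) (auto simp: insert_commute)
  moreover have "good_end A [a', b', y]" using y b aV a by (intro good_endI) (auto simp: insert_commute)
  moreover have "distinct ([x, b, a] @ v # [a', b', y])" using x y a b by auto
  moreover have "set ([x, b, a] @ [a', b', y]) \<inter> F = {}" using x y a b by auto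
  moreover have "tight E ([x, b, a] @ v # [a', b', y])"
    using nbD[OF b(10)] nbD[OF b(11)] nbD[of x "{v, a, b}"] nbD[of y "{v, a', b'}"] x(1) y(1)
    by (simp add: tight_Cons tight_3 insert_commute)
  ultimately show ?thesis unfolding insertable_def by blast
qed

end

lemma sum_at_most_one_large:
  fixes f :: "'a \<Rightarrow> nat"
  assumes "finite S" "card S \<le> n" "\<And>a. a \<in> S \<Longrightarrow> f a \<le> n"
    and "\<And>a a'. a \<in> S \<Longrightarrow> a' \<in> S \<Longrightarrow> a \<noteq> a' \<Longrightarrow> n \<le> 10 * f a \<Longrightarrow> n \<le> 10 * f a' \<Longrightarrow> False"
  shows "10 * sum f S \<le> n * n + 10 * n"
proof (cases "\<exists>a\<in>S. n \<le> 10 * f a")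
  case True
  then obtain a where a: "a \<in> S" "n \<le> 10 * f a" by blast
  have "10 * sum f S = 10 * f a + (\<Sum>x\<in>S - {a}. 10 * f x)"
    using sum.remove[OF assms(1) a(1), of f] by (simp add: sum_distrib_left)
  also have "\<dots> \<le> 10 * n + (\<Sum>x\<in>S - {a}. n)"
  proof (intro add_mono sum_mono)
    fix x assume "x \<in> S - {a}"
    then have "\<not> n \<le> 10 * f x" using assms(4)[of a x] a by blast
    then show "10 * f x \<le> n" by simp
  qed (use assms(3) a in auto)
  also have "\<dots> \<le> 10 * n + n * n"
    using assms(1,2) card_mono[of S "S - {a}"] by simp
  finally show ?thesis by simp
next
  case False
  have "10 * sum f S = (\<Sum>x\<in>S. 10 * f x)" by (simp add: sum_distrib_left)
  also have "\<dots> \<le> (\<Sum>x\<in>S. n)" using False by (intro sum_mono) (auto simp: not_le)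
  also have "\<dots> \<le> n * n" using assms(2) by simp
  finally show ?thesis by simp
qed

context near_extremal
begin

definition core :: "'a set \<Rightarrow> 'a \<Rightarrow> 'a set \<Rightarrow> 'a set" where
  "core X v F = {a \<in> X. a \<notin> F \<and> a \<noteq> v \<and> {a} \<notin> D}"

lemma card_core:
  assumes "X \<subseteq> V" "card X = n" "finite F" "1000 * card F \<le> n"
  shows "9 * n \<le> 10 * card (core X v F)"
proof -
  have "X \<subseteq> core X v F \<union> (insert v F \<union> {z \<in> V. insert z {} \<in> D})"
    using assms(1) unfolding core_def by auto
  then have "n \<le> card (core X v F \<union> (insert v F \<union> {z \<in> V. insert z {} \<in> D}))"
    using assms finite_V unfolding assms(2)[symmetric]
    by (intro card_mono) (auto simp: core_def intro: finite_subset)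
  also have "\<dots> \<le> card (core X v F) + (card (insert v F) + card {z \<in> V. insert z {} \<in> D})"
    by (intro order_trans[OF card_Un_le] add_left_mono card_Un_le)
  also have "\<dots> \<le> card (core X v F) + ((card F + 1) + g)"
    using few_bad[of "{}"] empty_notin_D assms(3) by (intro add_mono) (auto simp: card_insert_if)
  finally show ?thesis using assms(4) large by linarith
qed

text \<open>If \<open>insert_between_AA\<close> fails for \<open>a, a'\<close>, then
  \<open>v, a, a'\<close> has few neighbours in \<open>A\<close> and hence almost all of
  \<open>B\<close>. Were both summands at least \<open>n / 10\<close>, suitable \<open>b\<close> and
  \<open>b'\<close> would exist among these neighbours and \<open>insert_between_BAAB\<close> would
  apply. So at most one summand is that large.\<close>

lemma few_dense_if_not_insertable:
  assumes v: "v \<in> V" and F: "finite F" "1000 * card F \<le> n" and not: "\<not> insertable E A v F"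
  shows "10 * (\<Sum>a\<in>core A v F. card {b \<in> core B v F. n \<le> 50 * card (nb {v, a, b} \<inter> A)}) \<le> n * n + 10 * n"
proof (rule sum_at_most_one_large)
  show fin: "finite (core A v F)" unfolding core_def using finite_A by simp
  have "core A v F \<subseteq> A" "core B v F \<subseteq> B" unfolding core_def by auto
  then show "card (core A v F) \<le> n" using card_A card_mono[OF finite_A, of "core A v F"] by simp
  fix a
  let ?R = "\<lambda>a. {b \<in> core B v F. n \<le> 50 * card (nb {v, a, b} \<inter> A)}"
  have RB: "?R a \<subseteq> B" for a unfolding core_def by auto
  then show "card (?R a) \<le> n" using card_B card_mono[OF finite_B, of "?R a"] by simp
  fix a' assume a: "a \<in> core A v F" and a': "a' \<in> core A v F" and ne: "a \<noteq> a'"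
    and R: "n \<le> 10 * card (?R a)" and R': "n \<le> 10 * card (?R a')"
  have aA: "a \<in> A" "a' \<in> A" "a \<noteq> v" "a' \<noteq> v" "a \<notin> F" "a' \<notin> F" "{a} \<notin> D" "{a'} \<notin> D"
    using a a' unfolding core_def by auto
  have aV: "a \<in> V" "a' \<in> V" using aA in_V by auto
  have "\<not> n \<le> 50 * card (nb {v, a, a'} \<inter> A)"
    using insert_between_AA[OF v aA(1,2) ne aA(3-8) F] not by blast
  then have nbB: "n \<le> card (nb {v, a, a'} \<inter> B) + n div 50 + 1"
    using card_nb(2)[OF v aV] aA ne by auto
  have big: "n \<le> 50 * card (?R c \<inter> nb {v, a, a'})" if "n \<le> 10 * card (?R c)" for c
  proof -
    have "?R c \<inter> (nb {v, a, a'} \<inter> B) = ?R c \<inter> nb {v, a, a'}" using RB by blast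
    then have 1: "card (?R c) + card (nb {v, a, a'} \<inter> B)
        = card (?R c \<union> (nb {v, a, a'} \<inter> B)) + card (?R c \<inter> nb {v, a, a'})"
      using card_Un_Int[of "?R c" "nb {v, a, a'} \<inter> B"] finite_B finite_subset[OF RB] by simp
    have 2: "card (?R c \<union> (nb {v, a, a'} \<inter> B)) \<le> n"
      using RB card_mono[OF finite_B, of "?R c \<union> (nb {v, a, a'} \<inter> B)"] card_B by blast
    have 3: "50 * (n div 50) \<le> n" by simp
    have "n \<le> 50 * i" if "r + s = u + i" "u \<le> n" "50 * d \<le> n" "n \<le> s + d + 1" "n \<le> 10 * r" for r s u i d
      using that large by linarith
    from this[OF 1 2 3 nbB that] show ?thesis .
  qed
  have sub: "?R c \<inter> nb {v, a, a'} \<subseteq> V" for c using nb_subset by blast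
  obtain b where b: "b \<in> ?R a \<inter> nb {v, a, a'}" "b \<in> V" "b \<notin> F" "b \<notin> set [v, a, a']" "ok {b, a}"
    using pick[OF sub big[OF R] F, of "[v, a, a']" "{a}"] aV ok_singleton[OF aA(7)] by auto
  obtain b' where b': "b' \<in> ?R a' \<inter> nb {v, a, a'}" "b' \<in> V" "b' \<notin> F" "b' \<notin> set [v, a, a', b]" "ok {b', a'}"
    using pick[OF sub big[OF R'] F, of "[v, a, a', b]" "{a'}"] aV ok_singleton[OF aA(8)] by auto
  have "insertable E A v F"
    by (rule insert_between_BAAB[OF v aA(1,2) ne aA(3-6), of b b'])
      (use b b' F in \<open>auto simp: insert_commute\<close>)
  then show False using not by blast
qed

text \<open>If neither insertion is possible, then for almost all pairs \<open>a, b\<close> of typical vertices the triple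
  \<open>v, a, b\<close> has many neighbours neither in \<open>A\<close> nor in \<open>B\<close>.\<close>

lemma insertable_exists:
  assumes v: "v \<in> V" and F: "finite F" "1000 * card F \<le> n"
  shows "insertable E A v F \<or> insertable E B v F"
proof (rule ccontr)
  assume "\<not> ?thesis"
  then have notA: "\<not> insertable E A v F" and notB: "\<not> insertable E B v F" by auto
  interpret sw: near_extremal V D g B A E n by (rule swap)
  let ?R = "\<lambda>a. {b \<in> core B v F. n \<le> 50 * card (nb {v, a, b} \<inter> A)}"
  let ?S = "\<lambda>b. {a \<in> core A v F. n \<le> 50 * card (nb {v, b, a} \<inter> B)}"
  have cores: "core A v F \<subseteq> A" "core B v F \<subseteq> B" unfolding core_def by auto
  have fin: "finite (core A v F)" "finite (core B v F)" using cores finite_A finite_B finite_subset by auto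
  have "core A v F \<times> core B v F \<subseteq> (SIGMA a:core A v F. ?R a) \<union> (\<lambda>(b, a). (a, b)) ` (SIGMA b:core B v F. ?S b)"
  proof
    fix p assume "p \<in> core A v F \<times> core B v F"
    then obtain a b where p: "p = (a, b)" "a \<in> core A v F" "b \<in> core B v F" by blast
    then have "a \<in> V" "b \<in> V" "distinct [v, a, b]" using cores in_V disj unfolding core_def by auto
    then have "n \<le> 50 * card (nb {v, a, b} \<inter> A) \<or> n \<le> 50 * card (nb {v, b, a} \<inter> B)"
      using card_nb_dense(2)[OF v] by (auto simp: insert_commute)
    then show "p \<in> (SIGMA a:core A v F. ?R a) \<union> (\<lambda>(b, a). (a, b)) ` (SIGMA b:core B v F. ?S b)"
      using p by force
  qed
  then have "card (core A v F \<times> core B v F)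
      \<le> card ((SIGMA a:core A v F. ?R a) \<union> (\<lambda>(b, a). (a, b)) ` (SIGMA b:core B v F. ?S b))"
    using fin by (intro card_mono) auto
  also have "\<dots> \<le> card (SIGMA a:core A v F. ?R a) + card (SIGMA b:core B v F. ?S b)"
    using fin by (intro order_trans[OF card_Un_le] add_left_mono card_image_le) auto
  also have "\<dots> = (\<Sum>a\<in>core A v F. card (?R a)) + (\<Sum>b\<in>core B v F. card (?S b))"
    using fin by simp
  finally have sums: "card (core A v F) * card (core B v F)
      \<le> (\<Sum>a\<in>core A v F. card (?R a)) + (\<Sum>b\<in>core B v F. card (?S b))"
    unfolding card_cartesian_product .
  have "10 * p \<le> 2 * N" if "p \<le> s + t" "10 * s \<le> N" "10 * t \<le> N" for p s t N :: nat
    using that by linarith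
  from this[OF sums few_dense_if_not_insertable[OF v F notA] sw.few_dense_if_not_insertable[OF v F notB]]
  have "10 * (card (core A v F) * card (core B v F)) \<le> 2 * (n * n + 10 * n)" .
  then have "(10 * card (core A v F)) * (10 * card (core B v F)) \<le> 20 * (n * n + 10 * n)" by simp
  moreover have "(9 * n) * (9 * n) \<le> (10 * card (core A v F)) * (10 * card (core B v F))"
    using union by (intro mult_mono card_core[OF _ card_A F] card_core[OF _ card_B F]) auto
  \<comment> \<open>The cores span at least \<open>81 / 100\<close> of \<open>n * n\<close> pairs,
    while the two families covering them account for only about \<open>20 / 100\<close>.\<close>
  ultimately have "(9 * n) * (9 * n) \<le> 20 * (n * n + 10 * n)" by (rule order_trans[rotated])
  then have "61 * (n * n) \<le> 200 * n" by simp
  then have "61 * n \<le> 200" using large by (simp add: mult.assoc[symmetric])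
  then show False using large by simp
qed

section \<open>A path from one part to the other\<close>

text \<open>Prolong \<open>x a b\<close> backwards by \<open>r\<close> in \<open>A\<close>, then by
  \<open>q\<close> and \<open>p\<close>. This yields a good end unless \<open>r, x, a\<close> and
  then \<open>q, r, x\<close> both have many neighbours in \<open>B\<close> and few in
  \<open>A\<close>. In that case \<open>z a r x q p u\<close> with \<open>z, q, p\<close> in
  \<open>B\<close> already leads from one part to the other.\<close>

lemma end_or_bridge:
  assumes xV: "x \<in> V" and a: "a \<in> A" "{a} \<notin> D" and b: "b \<in> V" and dist: "distinct [x, a, b]"
    and F: "finite F" "1000 * card F \<le> n" and R: "n \<le> 50 * card (nb {x, a, b} \<inter> A)"
  shows "(\<exists>p q r. good_end A [p, q, r] \<and> distinct [p, q, r, x, a, b] \<and> {p, q, r} \<inter> F = {} \<and>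
      tight E [p, q, r, x, a, b]) \<or> (\<exists>Q. length Q \<le> 20 \<and> bridge E A B Q)"
proof -
  have aV: "a \<in> V" using a in_V by auto
  have sub: "nb T \<inter> X \<subseteq> V" for T X using nb_subset by blast
  obtain r where r: "r \<in> nb {x, a, b} \<inter> A" "r \<in> V" "r \<notin> F" "r \<notin> set [x, a, b]" "ok {r, a}"
    using pick[OF sub R F, of "[x, a, b]" "{a}"] aV ok_singleton a by auto
  have ok_r: "ok {r}" using r(5) ok_mono by blast
  have rxa: "distinct [r, x, a]" using r dist by auto
  have pqr: "\<exists>p q r. good_end A [p, q, r] \<and> distinct [p, q, r, x, a, b] \<and> {p, q, r} \<inter> F = {} \<and> tight E [p, q, r, x, a, b]"
    if q: "q \<in> nb {r, x, a}" "q \<notin> F" "q \<notin> set [x, a, b, r]"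
    and p: "p \<in> nb {q, r, x}" "p \<notin> F" "p \<notin> set [x, a, b, r, q]" "ok {p, q, r}" and qp: "q \<in> A \<or> p \<in> A" for p q
  proof -
    have "p \<in> V" "q \<in> V" using p q nb_subset by auto
    then have "good_end A [p, q, r]" using p q r qp by (intro good_endI) auto
    moreover have "tight E [p, q, r, x, a, b]"
      using nbD[OF p(1)] nbD[OF q(1)] nbD[of r "{x, a, b}"] r(1) by (simp add: tight_Cons tight_3)
    ultimately show ?thesis using p q r dist by (intro exI[of _ p] exI[of _ q] exI[of _ r]) auto
  qed
  show ?thesis
  proof (cases "n \<le> 50 * card (nb {r, x, a} \<inter> A)")
    case True
    obtain q where q: "q \<in> nb {r, x, a} \<inter> A" "q \<in> V" "q \<notin> F" "q \<notin> set [x, a, b, r]" "ok {q, r}"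
      using pick[OF sub True F, of "[x, a, b, r]" "{r}"] r(2) ok_r by auto
    have qr: "{q, r} \<subseteq> V" "card {q, r} \<le> 3" using q r by (auto simp: card_insert_if)
    have "n \<le> 50 * card (nb {q, r, x})" using q r xV by (intro card_nb_dense) auto
    then obtain p where p: "p \<in> nb {q, r, x}" "p \<in> V" "p \<notin> F" "p \<notin> set [x, a, b, r, q]" "ok {p, q, r}"
      using pick[OF nb_subset _ F _ qr q(5), of _ "[x, a, b, r, q]"] by auto
    show ?thesis using pqr[of q p] p q by blast
  next
    case False
    then have dB: "n \<le> 50 * card (nb {r, x, a} \<inter> B)" using card_nb_dense(2)[OF r(2) xV aV rxa] by blast
    obtain q where q: "q \<in> nb {r, x, a} \<inter> B" "q \<in> V" "q \<notin> F" "q \<notin> set [x, a, b, r]" "ok {q, r}"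
      using pick[OF sub dB F, of "[x, a, b, r]" "{r}"] r(2) ok_r by auto
    have qr: "{q, r} \<subseteq> V" "card {q, r} \<le> 3" using q r by (auto simp: card_insert_if)
    show ?thesis
    proof (cases "n \<le> 50 * card (nb {q, r, x} \<inter> A)")
      case True
      obtain p where p: "p \<in> nb {q, r, x} \<inter> A" "p \<in> V" "p \<notin> F" "p \<notin> set [x, a, b, r, q]" "ok {p, q, r}"
        using pick[OF sub True F _ qr q(5), of "[x, a, b, r, q]"] by auto
      show ?thesis using pqr[of q p] p q by blast
    next
      case False
      then have pB: "n \<le> 50 * card (nb {q, r, x} \<inter> B)"
        using card_nb_dense(2)[OF q(2) r(2) xV] q(4) r(4) by auto
      have ra: "{r, a} \<subseteq> V" "card {r, a} \<le> 3" using aV r by (auto simp: card_insert_if)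
      obtain z where z: "z \<in> nb {r, x, a} \<inter> B" "z \<in> V" "z \<notin> F" "z \<notin> set [x, a, b, r, q]" "ok {z, r, a}"
        using pick[OF sub dB F _ ra r(5), of "[x, a, b, r, q]"] by auto
      obtain p where p: "p \<in> nb {q, r, x} \<inter> B" "p \<in> V" "p \<notin> F" "p \<notin> set [x, a, b, r, q, z]" "ok {p, q}"
        using pick[OF sub pB F, of "[x, a, b, r, q, z]" "{q}"] q ok_mono[OF q(5), of "{q}"] by auto
      have pq: "{p, q} \<subseteq> V" "card {p, q} \<le> 3" using p q by (auto simp: card_insert_if)
      have "n \<le> 50 * card (nb {x, q, p})" using q p xV by (intro card_nb_dense) auto
      then obtain u where u: "u \<in> nb {x, q, p}" "u \<in> V" "u \<notin> F" "u \<notin> set [x, a, b, r, q, z, p]" "ok {u, p, q}"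
        using pick[OF nb_subset _ F _ pq p(5), of _ "[x, a, b, r, q, z, p]"] by auto
      interpret sw: near_extremal V D g B A E n by (rule swap)
      have "good_end A [z, a, r]" using z a r aV rxa by (intro good_endI) (auto simp: insert_commute)
      moreover have "good_end B [q, p, u]" using q p u by (intro good_endI) (auto simp: insert_commute)
      moreover have "tight E ([z, a, r] @ [x] @ [q, p, u])"
        using nbD[of z "{r, x, a}"] nbD[of q "{r, x, a}"] nbD[of p "{q, r, x}"] nbD[OF u(1)] z(1) q(1) p(1)
        by (simp add: tight_Cons tight_3 insert_commute)
      moreover have "distinct ([z, a, r] @ [x] @ [q, p, u])" using z q p u r dist by auto
      moreover have "set ([z, a, r] @ [x] @ [q, p, u]) \<subseteq> V" using z q p u r aV xV by auto
      ultimately have "bridge E A B ([z, a, r] @ [x] @ [q, p, u])" unfolding bridge_def by blast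
      then show ?thesis by (intro disjI2 exI[of _ "[z, a, r] @ [x] @ [q, p, u]"]) auto
    qed
  qed
qed

text \<open>The link graph of the pair \<open>a, b\<close> is connected, because it has \<open>2 n - 2\<close> vertices and
  minimum degree at least \<open>n - 1\<close>.\<close>

lemma crossing_edge:
  assumes a: "a \<in> V" "b \<in> V" "a \<noteq> b" and X: "X \<subseteq> V - {a, b}" "Y \<subseteq> V - {a, b}" "X \<union> Y = V - {a, b}"
    "X \<noteq> {}" "Y \<noteq> {}"
  obtains x y where "x \<in> X" "y \<in> Y" "x \<noteq> y" "{x, a, b, y} \<in> E"
proof -
  have cV: "card (V - {a, b}) = 2 * n - 2"
  proof -
    have "card V = 2 * n" using card_Un_disjoint[OF finite_A finite_B disj] union card_A card_B by simp
    then show ?thesis using a by (simp add: card_Diff_subset)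
  qed
  \<comment> \<open>At most \<open>card W - 1\<close> neighbours of \<open>z\<close> lie in
    \<open>W\<close>, fewer than the \<open>n - 1\<close> that are guaranteed.\<close>
  have nbz: "\<exists>w. w \<in> nb {z, a, b} \<and> w \<in> V - {a, b} - W \<and> w \<noteq> z"
    if z: "z \<in> W" and W: "W \<subseteq> V - {a, b}" "card W \<le> n - 1" for z W
  proof -
    have zd: "z \<in> V" "distinct [z, a, b]" using z W a by auto
    then have "card (nb {z, a, b}) \<ge> n - 1" using card_nb(1)[of z a b] a by linarith
    moreover have "finite W" using W finite_V by (meson Diff_subset finite_subset)
    moreover have "card (W - {z}) < n - 1" using W(2) z \<open>finite W\<close> large
      by (metis card_Diff1_less le_neq_implies_less less_le_trans not_le)
    ultimately have "\<not> nb {z, a, b} \<subseteq> W - {z}" by (intro not_subset_of_card_less) auto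
    then obtain w where w: "w \<in> nb {z, a, b}" "w \<notin> W - {z}" by blast
    moreover have "card {z, a, b} = 3" using zd by simp
    ultimately have "w \<notin> {z, a, b}" using nb_notin by blast
    then show ?thesis using w nb_subset by blast
  qed
  define Y' where "Y' = (V - {a, b}) - X"
  have Y'Y: "Y' \<subseteq> Y" unfolding Y'_def using X by blast
  have "card X + card Y' = 2 * n - 2"
    unfolding Y'_def cV[symmetric] using X(1) finite_V
    by (metis Diff_partition Diff_disjoint card_Un_disjoint finite_Diff finite_subset)
  then consider "card X \<le> n - 1" | "card Y' \<le> n - 1" "Y' \<noteq> {}" | "Y' = {}" by linarith
  then show ?thesis
  proof cases
    case 1
    obtain x where x: "x \<in> X" using X by blast
    obtain w where w: "w \<in> nb {x, a, b}" "w \<in> V - {a, b} - X" "w \<noteq> x" using nbz[OF x X(1) 1] by blast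
    moreover have "{x, a, b, w} \<in> E" using nbD[OF w(1)] by (simp add: insert_commute)
    moreover have "w \<in> Y" using w(2) X(3) by blast
    ultimately show ?thesis using that[of x w] x by blast
  next
    case 2
    obtain y where y: "y \<in> Y'" using 2 by blast
    have "Y' \<subseteq> V - {a, b}" unfolding Y'_def by blast
    then obtain w where w: "w \<in> nb {y, a, b}" "w \<in> V - {a, b} - Y'" "w \<noteq> y" using nbz[OF y _ 2(1)] by blast
    then have "w \<in> X" unfolding Y'_def by blast
    moreover have "{w, a, b, y} \<in> E" using nbD[OF w(1)] by (simp add: insert_commute)
    ultimately show ?thesis using that[of w y] w y Y'Y by blast
  next
    \<comment> \<open>\<open>X\<close> and \<open>Y\<close> may overlap. If \<open>X\<close> is
      everything, any vertex of \<open>Y\<close> together with any of its neighbours serves.\<close>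
    case 3
    then have XV: "X = V - {a, b}" using X unfolding Y'_def by blast
    obtain y where y: "y \<in> Y" using X by blast
    have "y \<in> {y}" "{y} \<subseteq> V - {a, b}" "card {y} \<le> n - 1" using y X large by auto
    then obtain w where w: "w \<in> nb {y, a, b}" "w \<in> V - {a, b} - {y}" using nbz by blast
    moreover have "{w, a, b, y} \<in> E" using nbD[OF w(1)] by (simp add: insert_commute)
    ultimately show ?thesis using that[of w y] y XV by blast
  qed
qed

text \<open>For \<open>x\<close> in \<open>A\<close> with \<open>x, a, b\<close> good, almost every
  further vertex of \<open>A\<close> completes a good set of type AAAB, hence an edge. This makes
  both classes in the connectivity argument nonempty.\<close>

lemma dense_extension_exists:
  assumes a: "a \<in> A" and b: "b \<in> B" and ok: "ok {a, b}"
  obtains x where "x \<in> V - {a, b}" "n \<le> 50 * card (nb {x, a, b} \<inter> A)"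
proof -
  have aV: "{a, b} \<subseteq> V" "card {a, b} \<le> 3" "a \<noteq> b" using a b in_V disj by (auto simp: card_insert_if)
  have "n \<le> 50 * card A" using card_A by simp
  then obtain x where x: "x \<in> A" "x \<in> V" "x \<notin> set [a, b]" "ok {x, a, b}"
    using pick[of A "{}" "[a, b]" "{a, b}"] aV ok union by auto
  have cx: "card {x, a, b} = 3" using x aV by (simp add: card_insert_if)
  have xV: "{x, a, b} \<subseteq> V" using x aV by blast
  have "A \<subseteq> (nb {x, a, b} \<inter> A) \<union> ({z \<in> V. \<not> ok (insert z {x, a, b})} \<union> set [x, a])"
  proof
    fix z assume z: "z \<in> A"
    show "z \<in> (nb {x, a, b} \<inter> A) \<union> ({z \<in> V. \<not> ok (insert z {x, a, b})} \<union> set [x, a])"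
    proof (cases "ok (insert z {x, a, b}) \<and> z \<noteq> x \<and> z \<noteq> a")
      case True
      let ?e = "insert z {x, a, b}"
      have "z \<noteq> b" using z b disj by blast
      then have "card ?e = 4" using True cx by (subst card_insert_disjoint) auto
      moreover have "?e \<inter> A = {z, x, a}" using z x a b disj by auto
      then have "card (?e \<inter> A) = 3" using True x by (simp add: card_insert_if)
      moreover have "?e \<notin> D" using True unfolding ok_def by blast
      moreover have "?e \<subseteq> V" using z xV in_V by blast
      ultimately have "?e \<in> E" using odd_edge[of ?e] by simp
      then show ?thesis using z in_V unfolding nb_def by blast
    next
      case False
      then show ?thesis using z in_V by auto
    qed
  qed
  then have "card A \<le> card ((nb {x, a, b} \<inter> A) \<union> ({z \<in> V. \<not> ok (insert z {x, a, b})} \<union> set [x, a]))"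
    using finite_A finite_V by (intro card_mono) auto
  also have "\<dots> \<le> card (nb {x, a, b} \<inter> A) + (card {z \<in> V. \<not> ok (insert z {x, a, b})} + card (set [x, a]))"
    by (intro order_trans[OF card_Un_le] add_left_mono card_Un_le)
  also have "\<dots> \<le> card (nb {x, a, b} \<inter> A) + (8 * g + 2)"
    using card_not_ok[OF xV _ x(4)] cx card_length[of "[x, a]"] by (intro add_left_mono add_mono) auto
  finally have "n \<le> 50 * card (nb {x, a, b} \<inter> A)" using card_A large by linarith
  then show ?thesis using that x by auto
qed

lemma bridge_exists: "\<exists>Q. length Q \<le> 20 \<and> bridge E A B Q"
proof -
  interpret sw: near_extremal V D g B A E n by (rule swap)
  have nA: "n \<le> 50 * card A" "n \<le> 50 * card B" using card_A card_B by auto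
  obtain a where a: "a \<in> A" "a \<in> V" "ok {a}"
    using pick[of A "{}" "[]" "{}"] nA union ok_empty by auto
  obtain b where b: "b \<in> B" "b \<in> V" "ok {b, a}"
    using pick[of B "{}" "[]" "{a}"] nA union a by auto
  have ab: "a \<noteq> b" using a b disj by blast
  have aD: "{a} \<notin> D" "{b} \<notin> D" using ok_memberD[OF b(3)] by auto
  define X where "X = {x \<in> V - {a, b}. n \<le> 50 * card (nb {x, a, b} \<inter> A)}"
  define Y where "Y = {x \<in> V - {a, b}. n \<le> 50 * card (nb {x, a, b} \<inter> B)}"
  have "X \<union> Y = V - {a, b}"
  proof -
    have "x \<in> X \<union> Y" if "x \<in> V - {a, b}" for x
      using card_nb_dense(2)[of x a b] that a b ab unfolding X_def Y_def by auto
    then show ?thesis unfolding X_def Y_def by blast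
  qed
  moreover have "ok {a, b}" using b(3) by (simp add: insert_commute)
  then obtain x0 where "x0 \<in> V - {a, b}" "n \<le> 50 * card (nb {x0, a, b} \<inter> A)"
    using dense_extension_exists[OF a(1) b(1)] by blast
  then have "X \<noteq> {}" unfolding X_def by blast
  moreover obtain y0 where "y0 \<in> V - {b, a}" "n \<le> 50 * card (nb {y0, b, a} \<inter> B)"
    using sw.dense_extension_exists[OF b(1) a(1) b(3)] by blast
  then have "y0 \<in> Y" unfolding Y_def by (simp add: insert_commute)
  then have "Y \<noteq> {}" by blast
  moreover have "X \<subseteq> V - {a, b}" "Y \<subseteq> V - {a, b}" unfolding X_def Y_def by auto
  ultimately obtain x y where xy: "x \<in> X" "y \<in> Y" "x \<noteq> y" "{x, a, b, y} \<in> E"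
    using crossing_edge[OF a(2) b(2) ab] by metis
  have xV: "x \<in> V" "x \<noteq> a" "x \<noteq> b" "n \<le> 50 * card (nb {x, a, b} \<inter> A)" using xy(1) unfolding X_def by auto
  have yV: "y \<in> V" "y \<noteq> a" "y \<noteq> b" "n \<le> 50 * card (nb {y, b, a} \<inter> B)"
    using xy(2) unfolding Y_def by (auto simp: insert_commute)
  \<comment> \<open>One prolongation avoids \<open>y\<close>, the other will avoid
    \<open>p, q, r, x\<close>; so they can be glued along the edge \<open>x a b y\<close>.\<close>
  consider (ends) p q r where "good_end A [p, q, r]" "distinct [p, q, r, x, a, b]" "{p, q, r} \<inter> {y} = {}"
      "tight E [p, q, r, x, a, b]" | (direct) "\<exists>Q. length Q \<le> 20 \<and> bridge E A B Q"
    using end_or_bridge[OF xV(1) a(1) aD(1) b(2) _ _ _ xV(4), of "{y}"] xV ab large by auto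
  then show ?thesis
  proof cases
    case (ends p q r)
    have "card {p, q, r, x} \<le> 4" by (simp add: card_insert_if)
    then have F: "finite {p, q, r, x}" "1000 * card {p, q, r, x} \<le> n" using large by auto
    consider (ends') p' q' r' where "good_end B [p', q', r']" "distinct [p', q', r', y, b, a]"
        "{p', q', r'} \<inter> {p, q, r, x} = {}" "tight E [p', q', r', y, b, a]"
      | (direct') "\<exists>Q. length Q \<le> 20 \<and> bridge E B A Q"
      using sw.end_or_bridge[OF yV(1) b(1) aD(2) a(2) _ F yV(4)] yV ab by auto
    then show ?thesis
    proof cases
      case (ends' p' q' r')
      let ?Q = "[p, q, r] @ [x, a, b, y] @ [r', q', p']"
      have "good_end B [r', q', p']" using good_end_rev[OF ends'(1)] by simp
      moreover have "tight E ?Q" using ends(4) ends'(4) xy(4) by (simp add: tight_Cons tight_3 insert_commute)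
      moreover have "distinct ?Q" using ends(2,3) ends'(2,3) xy(3) by auto
      moreover have "set ?Q \<subseteq> V" using ends(1) ends'(1) a b xV yV unfolding good_end_def by auto
      ultimately have "bridge E A B ?Q" using ends(1) unfolding bridge_def by blast
      then show ?thesis by (intro exI[of _ ?Q]) auto
    next
      case direct'
      then obtain Q where "length Q \<le> 20" "bridge E B A Q" by blast
      then show ?thesis using bridge_rev by (intro exI[of _ "rev Q"]) auto
    qed
  qed
qed

end

section \<open>Assembling the Hamiltonian path\<close>

context near_extremal
begin

text \<open>The inner flank \<open>ys\<close> is connected to the \<open>A\<close> end of
  \<open>Q\<close>, and the outer flank \<open>xs\<close> becomes the new end. The bound 13 is two
  triples, \<open>v\<close>, and at most six connecting vertices.\<close>

lemma absorb_left:
  assumes Q: "bridge E A B Q" and v: "v \<in> V" "v \<notin> set Q" and ins: "insertable E A v (set Q)"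
    and len: "1000 * length Q \<le> n"
  shows "\<exists>Q'. bridge E A B Q' \<and> insert v (set Q) \<subseteq> set Q' \<and> length Q' \<le> length Q + 13"
proof -
  obtain ts ms ss where Q': "Q = ts @ ms @ ss" "good_end A ts" "good_end B ss"
    and dQ: "distinct Q" "set Q \<subseteq> V" "tight E Q" using Q unfolding bridge_def by blast
  obtain xs ys where xy: "good_end A xs" "good_end A ys" "distinct (xs @ v # ys)" "set (xs @ ys) \<inter> set Q = {}"
    "tight E (xs @ v # ys)" using ins unfolding insertable_def by blast
  have l3: "length xs = 3" "length ys = 3" "length ts = 3" "set xs \<subseteq> V" "set ys \<subseteq> V"
    using xy Q' unfolding good_end_def by auto
  have "card (set Q \<union> set (v # xs)) \<le> length Q + 4"
    using card_Un_le[of "set Q" "set (v # xs)"] card_length[of Q] card_length[of "v # xs"] l3 by simp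
  then have "card (set Q \<union> set (v # xs)) + 12 + 32 * g < n" using len large by linarith
  moreover have "set ys \<inter> set ts = {}" using xy(4) Q'(1) by auto
  ultimately obtain cs where cs: "length cs \<le> 6" "distinct (ys @ cs @ ts)" "set cs \<subseteq> V"
      "set cs \<inter> (set Q \<union> set (v # xs)) = {}" "tight E (ys @ cs @ ts)"
    using connect[OF xy(2) Q'(2)] by (metis List.finite_set finite_UnI)
  have "tight E ((xs @ [v]) @ ys @ (cs @ ts))" by (rule tight_append) (use xy cs l3 in auto)
  then have t1: "tight E ((xs @ [v] @ ys @ cs) @ ts)" by simp
  have t2: "tight E (ts @ (ms @ ss))" using dQ Q'(1) by simp
  have "tight E ((xs @ [v] @ ys @ cs) @ ts @ (ms @ ss))" using tight_append[OF t1 t2] l3 by simp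
  then have "tight E (xs @ v # ys @ cs @ Q)" using Q'(1) by simp
  moreover have "distinct (xs @ v # ys @ cs @ Q)" using xy cs dQ v by auto
  moreover have "set (xs @ v # ys @ cs @ Q) \<subseteq> V" using l3 cs dQ v by auto
  moreover have "xs @ v # ys @ cs @ Q = xs @ (v # ys @ cs @ ts @ ms) @ ss" using Q'(1) by simp
  ultimately have "bridge E A B (xs @ v # ys @ cs @ Q)" unfolding bridge_def using xy(1) Q'(3) by blast
  then show ?thesis using cs(1) l3 by (intro exI[of _ "xs @ v # ys @ cs @ Q"]) auto
qed

lemma absorb:
  assumes Q: "bridge E A B Q" and v: "v \<in> V" "v \<notin> set Q" and len: "1000 * length Q \<le> n"
  shows "\<exists>Q'. bridge E A B Q' \<and> insert v (set Q) \<subseteq> set Q' \<and> length Q' \<le> length Q + 13"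
proof -
  interpret sw: near_extremal V D g B A E n by (rule swap)
  have "1000 * card (set Q) \<le> n" using len card_length[of Q] by linarith
  then consider "insertable E A v (set Q)" | "insertable E B v (set (rev Q))"
    using insertable_exists[OF v(1), of "set Q"] by auto
  then show ?thesis
  proof cases
    case 1
    then show ?thesis using absorb_left assms by blast
  next
    case 2
    then obtain Q' where Q': "bridge E B A Q'" "insert v (set (rev Q)) \<subseteq> set Q'" "length Q' \<le> length (rev Q) + 13"
      using sw.absorb_left[OF bridge_rev[OF Q] v(1) _ 2] v(2) len by auto
    then show ?thesis using bridge_rev[OF Q'(1)] by (intro exI[of _ "rev Q'"]) auto
  qed
qed

lemma absorb_set:
  assumes "finite S" "S \<subseteq> V" "card S \<le> g"
  shows "\<exists>Q. bridge E A B Q \<and> S \<subseteq> set Q \<and> length Q \<le> 20 + 13 * card S"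
  using assms
proof (induction S)
  case empty
  then show ?case using bridge_exists by auto
next
  case (insert v S)
  then obtain Q where Q: "bridge E A B Q" "S \<subseteq> set Q" "length Q \<le> 20 + 13 * card S" by auto
  show ?case
  proof (cases "v \<in> set Q")
    case True
    then show ?thesis using Q insert.hyps by (intro exI[of _ Q]) auto
  next
    case False
    have "card S + 1 \<le> g" using insert by simp
    then have "1000 * length Q \<le> n" using Q(3) large by linarith
    then obtain Q' where Q': "bridge E A B Q'" "insert v (set Q) \<subseteq> set Q'" "length Q' \<le> length Q + 13"
      using absorb[OF Q(1) _ False] insert.prems(1) by auto
    then show ?thesis using Q insert.hyps by (intro exI[of _ Q']) auto
  qed
qed

end

text \<open>The positions \<open>0, 1, 2\<close> belong to the end triple that is being prolonged.\<close>

definition class_count :: "nat \<Rightarrow> nat \<Rightarrow> nat" where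
  "class_count \<phi> N = card {i \<in> {3..<N + 3}. i mod 4 = \<phi>}"

lemma class_count_Suc: "class_count \<phi> (Suc N) = class_count \<phi> N + (if (N + 3) mod 4 = \<phi> then 1 else 0)"
proof -
  have *: "{3..<Suc N + 3} = insert (N + 3) {3..<N + 3}" by auto
  have "{i \<in> {3..<Suc N + 3}. i mod 4 = \<phi>}
      = (if (N + 3) mod 4 = \<phi> then insert (N + 3) {i \<in> {3..<N + 3}. i mod 4 = \<phi>} else {i \<in> {3..<N + 3}. i mod 4 = \<phi>})"
    unfolding * by auto
  then show ?thesis unfolding class_count_def by simp
qed

lemma class_count_le: "class_count \<phi> N \<le> N"
proof -
  have "class_count \<phi> N \<le> card {3..<N + 3}" unfolding class_count_def by (intro card_mono) auto
  then show ?thesis by simp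
qed

lemma class_count_bounds:
  assumes "\<phi> < 4"
  shows "N \<le> 4 * class_count \<phi> N + 3" "4 * class_count \<phi> N \<le> N + 6"
proof -
  have "N div 4 \<le> class_count \<phi> N"
    using card_residue_class[of "N + 3" 3 \<phi>] assms unfolding class_count_def by simp
  then show "N \<le> 4 * class_count \<phi> N + 3" by linarith
  have "inj_on (\<lambda>i. i div 4) {i \<in> {3..<N + 3}. i mod 4 = \<phi>}"
    by (rule inj_onI) (metis (mono_tags, lifting) div_mult_mod_eq mem_Collect_eq)
  then have "class_count \<phi> N = card ((\<lambda>i. i div 4) ` {i \<in> {3..<N + 3}. i mod 4 = \<phi>})"
    unfolding class_count_def by (simp add: card_image)
  also have "\<dots> \<le> card {..(N + 2) div 4}"
    by (intro card_mono) (auto intro!: div_le_mono)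
  finally have "class_count \<phi> N \<le> (N + 2) div 4 + 1" by simp
  then show "4 * class_count \<phi> N \<le> N + 6" by linarith
qed

text \<open>With \<open>L\<close> vertices prolonging the \<open>A\<close> end and
  \<open>M - L\<close> the \<open>B\<close> end, the patterns consume
  \<open>class_count \<phi> L + (M - L) - class_count \<psi> (M - L)\<close> vertices outside
  \<open>A\<close>. This is about \<open>11 * M / 16\<close> for \<open>L = M / 8\<close> and
  \<open>5 * M / 16\<close> for \<open>L = 7 * M / 8\<close>, while \<open>uB\<close> lies between
  \<open>3 * M / 8\<close> and \<open>5 * M / 8\<close>; a discrete intermediate value argument hits
  \<open>uB\<close> exactly.\<close>

lemma split_length_exists:
  assumes \<phi>: "\<phi> < 4" "\<psi> < 4" and M: "M = uA + uB" "8 * uA \<le> 5 * M" "8 * uB \<le> 5 * M" "1000 \<le> M"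
  obtains L where "M div 8 \<le> L" "L + M div 8 \<le> M" "uB + class_count \<psi> (M - L) = class_count \<phi> L + (M - L)"
proof -
  define h where "h L = int (class_count \<psi> (M - L)) - int (class_count \<phi> L) - int (M - L)" for L
  \<comment> \<open>Each of the two counts changes by 0 or 1 and lowers \<open>h\<close>, whereas
    the term \<open>M - L\<close> raises it by 1.\<close>
  have step: "\<forall>i. M div 8 \<le> i \<and> i < M - M div 8 \<longrightarrow> \<bar>h (Suc i) - h i\<bar> \<le> 1"
  proof (intro allI impI)
    fix i assume "M div 8 \<le> i \<and> i < M - M div 8"
    then have "M - i = Suc (M - Suc i)" by linarith
    then show "\<bar>h (Suc i) - h i\<bar> \<le> 1"
      unfolding h_def by (simp add: class_count_Suc)
  qed
  have m8: "8 * (M div 8) \<le> M" "M \<le> 8 * (M div 8) + 7" by auto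
  have lo: "h (M div 8) \<le> - int uB"
  proof -
    define x where "x = M div 8"
    have x: "8 * x \<le> M" unfolding x_def by simp
    have e: "int (M - x) = int M - int x" using x by linarith
    have "4 * int (class_count \<psi> (M - x)) \<le> int M - int x + 6" unfolding e[symmetric] using class_count_bounds(2)[OF \<phi>(2), of "M - x"] by linarith
    moreover have "int x \<le> 4 * int (class_count \<phi> x) + 3" using class_count_bounds(1)[OF \<phi>(1), of x] by linarith
    ultimately have "4 * h x \<le> - 3 * int M + 2 * int x + 9" unfolding h_def e right_diff_distrib by linarith
    then show ?thesis unfolding x_def[symmetric] using x M by linarith
  qed
  have hi: "- int uB \<le> h (M - M div 8)"
  proof -
    define x where "x = M div 8"
    have x: "8 * x \<le> M" unfolding x_def by simp
    have e: "int (M - x) = int M - int x" "M - (M - x) = x" using x by linarith+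
    have "int x \<le> 4 * int (class_count \<psi> x) + 3" using class_count_bounds(1)[OF \<phi>(2), of x] by linarith
    moreover have "4 * int (class_count \<phi> (M - x)) \<le> int M - int x + 6"
      unfolding e(1)[symmetric] using class_count_bounds(2)[OF \<phi>(1), of "M - x"] by linarith
    ultimately have "- int M - 2 * int x - 9 \<le> 4 * h (M - x)" unfolding h_def e right_diff_distrib by linarith
    then show ?thesis unfolding x_def[symmetric] using x M by linarith
  qed
  have "M div 8 \<le> M - M div 8" using m8 by linarith
  then obtain L where L: "M div 8 \<le> L" "L \<le> M - M div 8" "h L = - int uB"
    using nat_intermed_int_val[OF step _ lo hi] by blast
  show ?thesis
  proof (rule that)
    show "L + M div 8 \<le> M" using L m8 by linarith
    show "uB + class_count \<psi> (M - L) = class_count \<phi> L + (M - L)"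
      using L(3) unfolding h_def by linarith
  qed (use L in auto)
qed

context near_extremal
begin

lemma hamiltonian: "\<exists>vs. distinct vs \<and> set vs = V \<and> tight E vs"
proof -
  interpret sw: near_extremal V D g B A E n by (rule swap)
  define S where "S = {v \<in> V. {v} \<in> D}"
  have cS: "card S \<le> g" using few_bad[of "{}"] empty_notin_D unfolding S_def by simp
  obtain Q where Q: "bridge E A B Q" "S \<subseteq> set Q" "length Q \<le> 20 + 13 * card S"
    using absorb_set[OF _ _ cS] finite_V unfolding S_def by auto
  obtain ts ms ss where Q': "Q = ts @ ms @ ss" "good_end A ts" "good_end B ss"
    and dQ: "distinct Q" "set Q \<subseteq> V" "tight E Q" using Q(1) unfolding bridge_def by blast
  \<comment> \<open>Both ends are prolonged outwards, so the left triple is read backwards.\<close>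
  have rts: "good_end A (rev ts)" using Q'(2) by (rule good_end_rev)
  have l3: "length ts = 3" "length ss = 3" using Q' unfolding good_end_def by auto
  obtain \<phi> \<psi> where ends: "end_type A \<phi> (rev ts)" "end_type B \<psi> ss"
    using rts Q'(3) unfolding good_end_def by blast
  then have lt4: "\<phi> < 4" "\<psi> < 4" unfolding end_type_def by auto
  define U where "U = V - set Q"
  define M where "M = card U"
  have UV: "U \<subseteq> V" and U_D: "{u} \<notin> D" if "u \<in> U" for u
    using that Q(2) unfolding U_def S_def by auto
  have finU: "finite U" using finite_V unfolding U_def by simp
  have cV: "card V = 2 * n" using card_Un_disjoint[OF finite_A finite_B disj] union card_A card_B by simp
  have "M = 2 * n - length Q"
    unfolding M_def U_def using dQ cV by (simp add: card_Diff_subset distinct_card)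
  then have Mlow: "2 * n \<le> M + 20 + 13 * g" using Q(3) cS by linarith
  have UA: "U \<inter> A = U - B" and UB: "U \<inter> B = U - A" using union disj unfolding U_def by auto
  have M_sum: "M = card (U - B) + card (U - A)"
  proof -
    have "U = (U - B) \<union> (U - A)" "(U - B) \<inter> (U - A) = {}" using union disj unfolding U_def by auto
    then show ?thesis unfolding M_def using card_Un_disjoint[of "U - B" "U - A"] finU by auto
  qed
  have le_n: "card (U - B) \<le> n" "card (U - A) \<le> n"
    unfolding UA[symmetric] UB[symmetric]
    using card_mono[OF finite_A, of "U \<inter> A"] card_mono[OF finite_B, of "U \<inter> B"] card_A card_B by auto
  obtain L where L: "M div 8 \<le> L" "L + M div 8 \<le> M"
      "card (U - A) + class_count \<psi> (M - L) = class_count \<phi> L + (M - L)"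
    by (rule split_length_exists[OF lt4 M_sum]) (use le_n Mlow large in linarith)+
  have M8: "50000 * g + 50000 \<le> M div 8"
  proof -
    have "400000 * g + 400000 \<le> M" using Mlow large by linarith
    then show ?thesis by (subst less_eq_div_iff_mult_less_eq) auto
  qed
  have c1: "class_count \<phi> L \<le> card (U - A)" "L - class_count \<phi> L + class_count \<psi> (M - L) = card (U - B)"
    using L M_sum class_count_le[of \<phi> L] class_count_le[of \<psi> "M - L"] by linarith+
  \<comment> \<open>The left stretch gets exactly as many vertices outside \<open>A\<close> as its
    pattern demands; the equation for \<open>L\<close> then makes the counts on the right correct as
    well.\<close>
  obtain SB where SB: "SB \<subseteq> U - A" "card SB = class_count \<phi> L" "finite SB"
    using obtain_subset_with_card_n[OF c1(1)] by blast
  have "L - class_count \<phi> L \<le> card (U - B)" using c1(2) by linarith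
  then obtain SA where SA: "SA \<subseteq> U - B" "card SA = L - class_count \<phi> L" "finite SA"
    using obtain_subset_with_card_n by blast
  have SAB: "SA \<inter> SB = {}" using SA SB UV union by auto
  define UL where "UL = SA \<union> SB"
  define UR where "UR = U - UL"
  have cUL: "card UL = L"
    unfolding UL_def using card_Un_disjoint[OF SA(3) SB(3) SAB] SA(2) SB(2) class_count_le[of \<phi> L] by simp
  have ULU: "UL \<subseteq> U" unfolding UL_def using SA SB by blast
  have cUR: "card UR = M - L"
    unfolding UR_def M_def using ULU cUL finU by (simp add: card_Diff_subset finite_subset)
  have "UL - A = SB" unfolding UL_def using SA SB UA by blast
  then have kL: "card (UL - A) = card {i \<in> {3..<L + 3}. i mod 4 = \<phi>}"
    using SB(2) unfolding class_count_def by simp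
  have "UR - B = (U - B) - SA" unfolding UR_def UL_def using SB UB by blast
  then have "card (UR - B) = card (U - B) - card SA" using SA by (simp add: card_Diff_subset)
  then have kR: "card (UR - B) = card {i \<in> {3..<(M - L) + 3}. i mod 4 = \<psi>}"
    using SA(2) c1(2) unfolding class_count_def by linarith
  have inQ: "set (rev ts) \<subseteq> set Q" "set ss \<subseteq> set Q" using Q'(1) by auto
  obtain us where us: "set us = UL" "distinct (rev ts @ us)" "tight E (rev ts @ us)"
  proof (rule extend_end[OF rts ends(1) _ _ _ cUL kL])
    show "UL \<subseteq> V" "UL \<inter> set (rev ts) = {}" using ULU UV inQ unfolding U_def by auto
    show "{u} \<notin> D" if "u \<in> UL" for u using that ULU U_D by blast
    show "50000 * g + 50000 \<le> L" using M8 L(1) by linarith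
  qed
  obtain ws where ws: "set ws = UR" "distinct (ss @ ws)" "tight E (ss @ ws)"
  proof (rule sw.extend_end[OF Q'(3) ends(2) _ _ _ cUR kR])
    show "UR \<subseteq> V" "UR \<inter> set ss = {}" using UV inQ unfolding UR_def U_def by auto
    show "{u} \<notin> D" if "u \<in> UR" for u using that U_D unfolding UR_def by blast
    show "50000 * g + 50000 \<le> M - L" using M8 L(2) by linarith
  qed
  have t1: "tight E (rev us @ ts)" using tight_rev[OF us(3)] by simp
  have t2: "tight E (ts @ (ms @ ss))" using dQ Q'(1) by simp
  have t3: "tight E ((rev us @ ts @ ms) @ ss)" using tight_append[OF t1 t2] l3 by simp
  have "tight E ((rev us @ ts @ ms) @ ss @ ws)" using tight_append[OF t3 ws(3)] l3 by simp
  then have "tight E (rev us @ Q @ ws)" using Q'(1) by simp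
  moreover have "distinct (rev us @ Q @ ws)"
    using us ws dQ ULU unfolding UR_def U_def by auto
  moreover have "set (rev us @ Q @ ws) = V"
    using us ws dQ ULU unfolding UR_def U_def by auto
  ultimately show ?thesis by blast
qed

end

section \<open>Few non-edges give few bad sets\<close>

text \<open>For \<open>z\<close> outside \<open>S\<close>, the pair of \<open>insert z S\<close> and
  \<open>z\<close> determines \<open>S\<close>, and each member of \<open>X\<close> offers at most
  \<open>k\<close> choices of \<open>z\<close>.\<close>

lemma sum_extensions_le:
  assumes "finite V" "finite \<S>" "finite X" "\<And>e. e \<in> X \<Longrightarrow> finite e \<and> card e \<le> k"
  shows "(\<Sum>S\<in>\<S>. card {z \<in> V - S. insert z S \<in> X}) \<le> k * card X"
proof -
  let ?P = "SIGMA S:\<S>. {z \<in> V - S. insert z S \<in> X}"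
  have "inj_on (\<lambda>(S, z). (insert z S, z)) ?P"
  proof (rule inj_onI)
    fix p q assume "p \<in> ?P" "q \<in> ?P" and eq: "(\<lambda>(S, z). (insert z S, z)) p = (\<lambda>(S, z). (insert z S, z)) q"
    moreover obtain S z T w where "p = (S, z)" "q = (T, w)" by (metis surj_pair)
    ultimately have pq: "p = (S, z)" "q = (T, z)" "insert z S = insert z T" "z \<notin> S" "z \<notin> T" by auto
    then have "S = T" by (metis insert_ident)
    then show "p = q" using pq by simp
  qed
  then have "card ?P = card ((\<lambda>(S, z). (insert z S, z)) ` ?P)" by (rule card_image[symmetric])
  also have "\<dots> \<le> card (SIGMA e:X. e)"
    using assms by (intro card_mono finite_SigmaI) auto
  also have "\<dots> = (\<Sum>e\<in>X. card e)" using assms by (intro card_SigmaI) auto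
  also have "\<dots> \<le> (\<Sum>e\<in>X. k)" using assms(4) by (intro sum_mono) auto
  finally show ?thesis using assms(1,2) by (simp add: mult.commute)
qed

lemma card_le_sum_extensions:
  assumes "finite V" "finite \<S>" "\<And>e. e \<in> X \<Longrightarrow> \<exists>S z. S \<in> \<S> \<and> z \<in> V - S \<and> e = insert z S"
  shows "card X \<le> (\<Sum>S\<in>\<S>. card {z \<in> V - S. insert z S \<in> X})"
proof -
  let ?P = "SIGMA S:\<S>. {z \<in> V - S. insert z S \<in> X}"
  have sub: "X \<subseteq> (\<lambda>(S, z). insert z S) ` ?P"
  proof
    fix e assume e: "e \<in> X"
    then obtain S z where "S \<in> \<S>" "z \<in> V - S" "e = insert z S" using assms(3) by blast
    then show "e \<in> (\<lambda>(S, z). insert z S) ` ?P" using e by (intro image_eqI[of _ _ "(S, z)"]) auto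
  qed
  have fin: "finite ?P" using assms(1,2) by (intro finite_SigmaI) auto
  have "card X \<le> card ?P" by (rule surj_card_le[OF fin sub])
  then show ?thesis using assms(1,2) by simp
qed

text \<open>Each missing AAAB set contains an AAB triple. For such a triple, the missing extensions
  into \<open>A\<close> are no more numerous than the edges into \<open>B\<close>, by the degree
  condition. Each AABB edge is charged by at most four triples.\<close>

lemma card_non_edges_le:
  assumes fin: "finite V" and AB: "A \<union> B = V" "A \<inter> B = {}" "card A = n"
    and E4: "\<And>e. e \<in> E \<Longrightarrow> e \<subseteq> V \<and> card e = 4"
    and codegree: "\<And>T. T \<subseteq> V \<Longrightarrow> card T = 3 \<Longrightarrow> n \<le> card {x \<in> V. insert x T \<in> E} + 1"
  shows "card {e. e \<subseteq> V \<and> card e = 4 \<and> card (e \<inter> A) = 3 \<and> e \<notin> E} \<le> 4 * card {e \<in> E. card (e \<inter> A) = 2}"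
    (is "card ?X \<le> 4 * card ?Y")
proof -
  let ?S = "{S. S \<subseteq> V \<and> card S = 3 \<and> card (S \<inter> A) = 2}"
  have finS: "finite ?S" by (rule finite_subset[of _ "Pow V"]) (use fin in auto)
  have finA: "finite A" and finB: "finite B" using fin AB by auto
  have finE: "finite E" by (rule finite_subset[of E "Pow V"]) (use fin E4 in auto)
  have "card ?X \<le> (\<Sum>S\<in>?S. card {z \<in> V - S. insert z S \<in> ?X})"
  proof (rule card_le_sum_extensions[OF fin finS])
    fix e assume e: "e \<in> ?X"
    then have "e \<inter> A \<noteq> {}" by auto
    then obtain z where z: "z \<in> e" "z \<in> A" by blast
    have fe: "finite e" using e fin finite_subset by blast
    have "(e - {z}) \<inter> A = (e \<inter> A) - {z}" by blast
    then have "e - {z} \<in> ?S" using e z fe by (auto simp: card_Diff_singleton)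
    moreover have "z \<in> V - (e - {z})" "e = insert z (e - {z})" using z AB by auto
    ultimately show "\<exists>S z. S \<in> ?S \<and> z \<in> V - S \<and> e = insert z S" by blast
  qed
  also have "\<dots> \<le> (\<Sum>S\<in>?S. card {z \<in> V - S. insert z S \<in> ?Y})"
  proof (rule sum_mono)
    fix S assume S: "S \<in> ?S"
    have fS: "finite S" using S fin finite_subset by blast
    let ?G = "{x \<in> V. insert x S \<in> E}"
    have GS: "?G \<inter> S = {}"
    proof -
      have "insert x S \<notin> E" if "x \<in> S" for x using that S E4[of "insert x S"] by (auto simp: insert_absorb)
      then show ?thesis by blast
    qed
    have "{z \<in> V - S. insert z S \<in> ?X} \<subseteq> (A - S) - ?G"
    proof
      fix z assume z: "z \<in> {z \<in> V - S. insert z S \<in> ?X}"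
      have "z \<in> A"
      proof (rule ccontr)
        assume "z \<notin> A"
        then have "insert z S \<inter> A = S \<inter> A" by blast
        then show False using z S by simp
      qed
      then show "z \<in> (A - S) - ?G" using z by auto
    qed
    then have "card {z \<in> V - S. insert z S \<in> ?X} \<le> card ((A - S) - ?G)"
      using finA by (intro card_mono) auto
    moreover have "card ((A - S) - ?G) + card (?G \<inter> A) = n - 2"
    proof -
      have "(A - S) \<inter> ?G = ?G \<inter> A" using GS by blast
      then have "card (A - S) = card (?G \<inter> A) + card ((A - S) - ?G)"
        using card_Int_Diff[of "A - S" ?G] finA by simp
      moreover have "card (A - S) = card A - card (S \<inter> A)"
        using card_Diff_subset_Int[of A S] fS by (simp add: Int_commute)
      ultimately show ?thesis using S AB(3) by simp
    qed
    moreover have "card ?G = card (?G \<inter> A) + card (?G \<inter> B)"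
    proof -
      have "?G - A = ?G \<inter> B" using AB by blast
      then show ?thesis using card_Int_Diff[of ?G A] fin by simp
    qed
    moreover have "n \<le> card ?G + 1" using codegree S by blast
    ultimately have "card {z \<in> V - S. insert z S \<in> ?X} \<le> card (?G \<inter> B)" by linarith
    also have "\<dots> \<le> card {z \<in> V - S. insert z S \<in> ?Y}"
    proof (rule card_mono)
      show "?G \<inter> B \<subseteq> {z \<in> V - S. insert z S \<in> ?Y}"
      proof
        fix z assume z: "z \<in> ?G \<inter> B"
        then have "z \<notin> A" using AB by blast
        then have "insert z S \<inter> A = S \<inter> A" by blast
        then show "z \<in> {z \<in> V - S. insert z S \<in> ?Y}" using z S GS by auto
      qed
    qed (use fin in auto)
    finally show "card {z \<in> V - S. insert z S \<in> ?X} \<le> card {z \<in> V - S. insert z S \<in> ?Y}" .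
  qed
  also have "\<dots> \<le> 4 * card ?Y"
    using fin finS finE E4 by (intro sum_extensions_le) (auto intro: card_ge_0_finite)
  finally show ?thesis .
qed

section \<open>From few missing sets to a hereditary family of bad sets\<close>

definition heavy :: "'a set \<Rightarrow> nat \<Rightarrow> nat \<Rightarrow> 'a set set \<Rightarrow> 'a set set" where
  "heavy V g k X = {S. S \<subseteq> V \<and> card S = k \<and> g < card {z \<in> V - S. insert z S \<in> X}}"

lemma card_heavy:
  assumes "finite V" "\<And>e. e \<in> X \<Longrightarrow> e \<subseteq> V \<and> card e = l"
  shows "(g + 1) * card (heavy V g k X) \<le> l * card X"
proof -
  have fX: "finite X" by (rule finite_subset[of X "Pow V"]) (use assms in auto)
  have fH: "finite (heavy V g k X)" by (rule finite_subset[of _ "Pow V"]) (use assms(1) in \<open>auto simp: heavy_def\<close>)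
  have "(g + 1) * card (heavy V g k X) = (\<Sum>S\<in>heavy V g k X. g + 1)" by simp
  also have "\<dots> \<le> (\<Sum>S\<in>heavy V g k X. card {z \<in> V - S. insert z S \<in> X})"
    by (rule sum_mono) (auto simp: heavy_def)
  also have "\<dots> \<le> l * card X"
  proof (rule sum_extensions_le[OF assms(1) fH fX])
    show "finite e \<and> card e \<le> l" if "e \<in> X" for e
      using assms(2)[OF that] assms(1) finite_subset by auto
  qed
  finally show ?thesis .
qed

text \<open>Each level consists of the sets with more than \<open>g\<close> extensions to the level
  above, so the required bound holds by construction for nonempty good sets. Averaging loses the
  factors 4, 3 and 2, in total 24, and gains \<open>g + 1\<close> three times; hence at most
  \<open>g\<close> singletons are bad, which settles the empty set.\<close>

lemma bad_sets_exists:
  assumes fin: "finite V" and X: "\<And>e. e \<in> X \<Longrightarrow> e \<subseteq> V \<and> card e = 4" and few: "24 * card X < (g + 1) ^ 4"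
  obtains D where "bad_sets V D g" "X \<subseteq> D"
proof -
  define X3 where "X3 = heavy V g 3 X"
  define X2 where "X2 = heavy V g 2 X3"
  define X1 where "X1 = heavy V g 1 X2"
  define D where "D = X \<union> X3 \<union> X2 \<union> X1"
  have X3: "e \<subseteq> V \<and> card e = 3" if "e \<in> X3" for e using that unfolding X3_def heavy_def by auto
  have X2: "e \<subseteq> V \<and> card e = 2" if "e \<in> X2" for e using that unfolding X2_def heavy_def by auto
  have X1: "e \<subseteq> V \<and> card e = 1" if "e \<in> X1" for e using that unfolding X1_def heavy_def by auto
  have fX1: "finite X1" by (rule finite_subset[of X1 "Pow V"]) (use X1 fin in auto)
  define h where "h = g + 1"
  have 3: "h * card X3 \<le> 4 * card X" unfolding X3_def h_def by (rule card_heavy[OF fin X])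
  have 2: "h * card X2 \<le> 3 * card X3" unfolding X2_def h_def by (rule card_heavy[OF fin X3])
  have 1: "h * card X1 \<le> 2 * card X2" unfolding X1_def h_def by (rule card_heavy[OF fin X2])
  have "h ^ 3 * card X1 = h ^ 2 * (h * card X1)" by (simp add: power2_eq_square power3_eq_cube)
  also have "\<dots> \<le> h ^ 2 * (2 * card X2)" using 1 by (intro mult_left_mono) auto
  also have "\<dots> = 2 * h * (h * card X2)" by (simp add: power2_eq_square)
  also have "\<dots> \<le> 2 * h * (3 * card X3)" using 2 by (intro mult_left_mono) auto
  also have "\<dots> = 6 * (h * card X3)" by simp
  also have "\<dots> \<le> 6 * (4 * card X)" using 3 by (intro mult_left_mono) auto
  also have "\<dots> < h ^ 3 * h" using few unfolding h_def[symmetric] by (simp add: power3_eq_cube power4_eq_xxxx)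
  finally have "card X1 < h" by simp
  then have cX1: "card X1 \<le> g" unfolding h_def by simp
  have "bad_sets V D g"
  proof
    show "{} \<notin> D" using X X3 X2 X1 unfolding D_def by fastforce
    fix S assume S: "S \<subseteq> V" "card S \<le> 3" "S \<notin> D"
    have fS: "finite S" using S fin finite_subset by blast
    have eq: "{z \<in> V. insert z S \<in> D} = {z \<in> V - S. insert z S \<in> D}" using S(3) by (auto simp: insert_absorb)
    have cs: "card (insert z S) = card S + 1" if "z \<in> V - S" for z using that fS by simp
    consider "card S = 3" | "card S = 2" | "card S = 1" | "card S = 0" using S(2) by linarith
    then show "card {z \<in> V. insert z S \<in> D} \<le> g"
    proof cases
      case 1
      then have "{z \<in> V. insert z S \<in> D} = {z \<in> V - S. insert z S \<in> X}"
        unfolding eq using cs X X3 X2 X1 unfolding D_def by fastforce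
      then show ?thesis using S 1 unfolding D_def X3_def heavy_def by (auto simp: not_less)
    next
      case 2
      then have "{z \<in> V. insert z S \<in> D} = {z \<in> V - S. insert z S \<in> X3}"
        unfolding eq using cs X X3 X2 X1 unfolding D_def by fastforce
      then show ?thesis using S 2 unfolding D_def X2_def heavy_def by (auto simp: not_less)
    next
      case 3
      then have "{z \<in> V. insert z S \<in> D} = {z \<in> V - S. insert z S \<in> X2}"
        unfolding eq using cs X X3 X2 X1 unfolding D_def by fastforce
      then show ?thesis using S 3 unfolding D_def X1_def heavy_def by (auto simp: not_less)
    next
      case 4
      then have S0: "S = {}" using fS by simp
      then have "{z \<in> V. insert z S \<in> D} \<subseteq> {z \<in> V. {z} \<in> X1}"
        unfolding eq using cs X X3 X2 X1 unfolding D_def by fastforce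
      then have "card {z \<in> V. insert z S \<in> D} \<le> card {z \<in> V. {z} \<in> X1}" using fin by (intro card_mono) auto
      also have "\<dots> = card ((\<lambda>z. {z}) ` {z \<in> V. {z} \<in> X1})" by (rule card_image[symmetric]) auto
      also have "\<dots> \<le> card X1" using X1 fin by (intro card_mono fX1) auto
      finally show ?thesis using cX1 by simp
    qed
  qed (use fin in auto)
  then show ?thesis using that unfolding D_def by blast
qed

section \<open>From the hypotheses on degree and bisection to the locale\<close>

lemma hamiltonian_path_exists:
  assumes V: "four_graph V E" "card V = 2 * n" and A: "A \<union> B = V" "A \<inter> B = {}" "card A = card B"
    and few: "192 * card (edges_AABB E A) < (n div 2000000 + 1) ^ 4"
    and deg: "n \<le> delta3 V E + 1" and n: "2000000 \<le> n"
  shows "\<exists>vs. hamiltonian_path V E vs"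
proof -
  define g where "g = n div 2000000"
  have fin: "finite V" and E4: "\<And>e. e \<in> E \<Longrightarrow> e \<subseteq> V \<and> card e = 4"
    using V(1) unfolding four_graph_def nsets_def by auto
  have finAB: "finite A" "finite B" using fin A by auto
  have cAB: "card A = n" "card B = n" using card_Un_disjoint[OF finAB A(2)] A V(2) by auto
  have codegree: "n \<le> card {x \<in> V. insert x T \<in> E} + 1" if T: "T \<subseteq> V" "card T = 3" for T
  proof -
    have "T \<in> nsets V 3" using T fin finite_subset unfolding nsets_def by auto
    then have "delta3 V E \<le> card {x \<in> V. T \<union> {x} \<in> E}"
      unfolding delta3_def using fin by (intro Min_le) (auto simp: finite_imp_finite_nsets)
    then show ?thesis using deg by simp
  qed
  have split: "card (e \<inter> A) + card (e \<inter> B) = card e" if "e \<subseteq> V" for e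
  proof -
    have "e = (e \<inter> A) \<union> (e \<inter> B)" "(e \<inter> A) \<inter> (e \<inter> B) = {}" using that A by auto
    then show ?thesis using finAB by (metis card_Un_disjoint finite_Int)
  qed
  have finX: "finite {e. e \<subseteq> V \<and> P e}" for P
    by (rule finite_subset[of _ "Pow V"]) (use fin in auto)
  define X where "X = {e. e \<subseteq> V \<and> card e = 4 \<and> odd (card (e \<inter> A)) \<and> e \<notin> E}"
  have "X \<subseteq> {e. e \<subseteq> V \<and> card e = 4 \<and> card (e \<inter> A) = 3 \<and> e \<notin> E} \<union> {e. e \<subseteq> V \<and> card e = 4 \<and> card (e \<inter> B) = 3 \<and> e \<notin> E}"
    (is "_ \<subseteq> ?X3 \<union> ?X1")
  proof
    fix e assume e: "e \<in> X"
    then have "card (e \<inter> A) + card (e \<inter> B) = 4" "odd (card (e \<inter> A))" using split unfolding X_def by auto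
    then have "card (e \<inter> A) = 3 \<or> card (e \<inter> B) = 3" by presburger
    then show "e \<in> ?X3 \<union> ?X1" using e unfolding X_def by blast
  qed
  then have "card X \<le> card (?X3 \<union> ?X1)" using fin by (intro card_mono) (auto simp: finX)
  also have "\<dots> \<le> card ?X3 + card ?X1" by (rule card_Un_le)
  also have "\<dots> \<le> 4 * card {e \<in> E. card (e \<inter> A) = 2} + 4 * card {e \<in> E. card (e \<inter> B) = 2}"
    using A cAB by (intro add_mono card_non_edges_le[OF fin _ _ _ E4 codegree]) auto
  also have "{e \<in> E. card (e \<inter> B) = 2} = {e \<in> E. card (e \<inter> A) = 2}"
  proof (rule Collect_cong, rule conj_cong[OF refl])
    fix e assume "e \<in> E"
    then have "card (e \<inter> A) + card (e \<inter> B) = 4" using split E4 by metis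
    then show "(card (e \<inter> B) = 2) = (card (e \<inter> A) = 2)" by linarith
  qed
  finally have "card X \<le> 8 * card (edges_AABB E A)" unfolding edges_AABB_def by simp
  then have "24 * card X < (g + 1) ^ 4" using few unfolding g_def by linarith
  then obtain D where D: "bad_sets V D g" "X \<subseteq> D"
    using bad_sets_exists[OF fin, of X g] unfolding X_def by blast
  interpret near_extremal V D g A B E n
  proof (intro near_extremal.intro near_extremal_axioms.intro D(1))
    \<comment> \<open>Half of \<open>n\<close> pays for the multiple of \<open>g\<close>, the other
      half for the additive constant; this is the origin of 2000000.\<close>
    show "1000000 * g + 1000000 \<le> n" using n unfolding g_def by linarith
    show "e \<in> E" if "e \<subseteq> V" "card e = 4" "odd (card (e \<inter> A))" "e \<notin> D" for e
      using that D(2) unfolding X_def by blast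
  qed (use A cAB codegree E4 in auto)
  show ?thesis
    using hamiltonian unfolding hamiltonian_path_def is_path_def tight_def by auto
qed

theorem theorem3p1:
  "\<exists>\<epsilon>\<^sub>0::real. \<epsilon>\<^sub>0 > 0 \<and>
     (\<forall>\<^sub>F n::nat in sequentially.
        \<forall>(V :: 'a set) (E :: 'a set set).
          four_graph V E \<longrightarrow> card V = 2 * n \<longrightarrow>
          real (bisection_min V E) < \<epsilon>\<^sub>0 * real n ^ 4 \<longrightarrow>
          int (delta3 V E) \<ge> int n - 1 \<longrightarrow>
          (\<exists>vs. hamiltonian_path V E vs))"
proof (intro exI[of _ "1 / (192 * 2000000 ^ 4) :: real"] conjI eventually_sequentiallyI[of 2000000] allI impI)
  fix n :: nat and V :: "'a set" and E :: "'a set set"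
  assume n: "2000000 \<le> n" and V: "four_graph V E" "card V = 2 * n"
    and few: "real (bisection_min V E) < 1 / (192 * 2000000 ^ 4) * real n ^ 4"
    and deg: "int (delta3 V E) \<ge> int n - 1"
  have fin: "finite V" using V(1) unfolding four_graph_def by blast
  let ?f = "\<lambda>(A, B). card (edges_AABB E A)"
  have finb: "finite (bisections V)"
    by (rule finite_subset[of "bisections V" "Pow V \<times> Pow V"]) (use fin in \<open>auto simp: bisections_def\<close>)
  \<comment> \<open>Some bisection exists, so the minimum is taken over a nonempty finite set and is
    attained.\<close>
  obtain A0 where A0: "A0 \<subseteq> V" "card A0 = n" "finite A0"
    using obtain_subset_with_card_n[of n V] V(2) by auto
  then have "(A0, V - A0) \<in> bisections V"
    using V(2) unfolding bisections_def by (auto simp: card_Diff_subset)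
  then have "Min (?f ` bisections V) \<in> ?f ` bisections V" using finb by (intro Min_in) auto
  then obtain A B where AB: "(A, B) \<in> bisections V" "bisection_min V E = card (edges_AABB E A)"
    unfolding bisection_min_def by force
  \<comment> \<open>The factor 192 is 24 from the three averaging levels times 8 from charging
    missing AAAB and ABBB sets to AABB edges, 4 for each type.\<close>
  have "real (192 * card (edges_AABB E A)) < (real n / 2000000) ^ 4"
    using few unfolding AB(2) by (simp add: power_divide field_simps)
  also have "\<dots> \<le> real (n div 2000000 + 1) ^ 4"
  proof (rule power_mono)
    have "n < 2000000 * (n div 2000000 + 1)"
      using dividend_less_times_div[of 2000000 n] by simp
    then have "real n < real (2000000 * (n div 2000000 + 1))" by (rule of_nat_less_iff[THEN iffD2])
    then show "real n / 2000000 \<le> real (n div 2000000 + 1)" by simp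
  qed simp
  also have "\<dots> = real ((n div 2000000 + 1) ^ 4)" by simp
  finally have "192 * card (edges_AABB E A) < (n div 2000000 + 1) ^ 4" by (rule of_nat_less_iff[THEN iffD1])
  moreover have "n \<le> delta3 V E + 1" using deg by linarith
  ultimately show "\<exists>vs. hamiltonian_path V E vs"
    using AB(1) n by (intro hamiltonian_path_exists[OF V, of A B]) (auto simp: bisections_def)
qed simp

end
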